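(* Let $n\ge2$ and $G=\langle z\mapsto e^{2\pi i/n}z\rangle\simeq\mathbb Z_n$. For any finite subset $\alpha\subseteq\widehat{\mathbb C}$ with $|\alpha|\ge3$, the stabilizer $\mathcal A_\alpha$ equals $G$ if and only if all three of the following hold: 1. $\alpha$ is a union of certain elements of $\{\{\infty\},\{0\}\}\cup\{C_n(z)\mid z\in\mathbb C^*\}$; 2. for every integer $p\ge2$, $\alpha$ is not a union of certain elements of $\{\{\infty\},\{0\}\}\cup\{C_{pn}(z)\mid z\in\mathbb C^*\}$; 3. $\mathcal A_\alpha$ is not isomorphic to $A_5$, $S_4$, $A_4$ or a dihedral group $D_m$ with $m\ge2$ (that is, $\alpha$ is not in the icosahedral, octahedral, tetrahedral or dihedral case).
   Context: $\widehat{\mathbb C}=\mathbb C\cup\{\infty\}$, $\mathbb C^*=\mathbb C\setminus\{0\}$. For $\alpha\subseteq\widehat{\mathbb C}$, $\mathcal A_\alpha$ is the group of all Möbius transformations $f\in\mathrm{PSL}(2,\mathbb C)$ with $f(\alpha)=\alpha$. $\mathbb Z_n$ is the cyclic group of order $n$; $D_m$ is the dihedral group of order $2m$ (with $D_2$ the Klein four-group). For an integer $m\ge2$ and $z\in\mathbb C^*$, $C_m(z)=\{e^{\frac{j}{m}2\pi i}z\mid j\in\mathbb Z\}$. *)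

theory Defs
  imports Complex_Main "HOL-Algebra.Algebra"
begin

text \<open>The Riemann sphere is \<^typ>\<open>complex option\<close>, with \<^term>\<open>None\<close> in the role of \<open>\<infinity>\<close>.\<close>

type_synonym riemann_sphere = "complex option"

fun moebius :: "complex \<Rightarrow> complex \<Rightarrow> complex \<Rightarrow> complex \<Rightarrow> riemann_sphere \<Rightarrow> riemann_sphere" where
  "moebius a b c d None = (if c = 0 then None else Some (a / c))"
| "moebius a b c d (Some z) =
     (if c * z + d = 0 then None else Some ((a * z + b) / (c * z + d)))"

text \<open>
  Elements of \<open>PSL(2,\<complex>)\<close> are identified with the maps they induce on the sphere: the action is
  faithful, and rescaling a matrix with \<open>a d - b c \<noteq> 0\<close> to determinant 1 does not change its map.
\<close>

definition moebius_group :: "(riemann_sphere \<Rightarrow> riemann_sphere) monoid" where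
  "moebius_group =
     \<lparr>carrier = {moebius a b c d | a b c d. a * d - b * c \<noteq> 0}, monoid.mult = (\<circ>), one = id\<rparr>"

definition setwise_stabilizer :: "riemann_sphere set \<Rightarrow> (riemann_sphere \<Rightarrow> riemann_sphere) monoid" where
  "setwise_stabilizer \<alpha> = moebius_group\<lparr>carrier := {f \<in> carrier moebius_group. f ` \<alpha> = \<alpha>}\<rparr>"

definition rotation :: "nat \<Rightarrow> riemann_sphere \<Rightarrow> riemann_sphere" where
  "rotation n = map_option (\<lambda>z. exp (2 * of_real pi * \<i> / of_nat n) * z)"

definition rotation_group :: "nat \<Rightarrow> (riemann_sphere \<Rightarrow> riemann_sphere) monoid" where
  "rotation_group n = subgroup_generated moebius_group {rotation n}"

definition circle_orbit :: "nat \<Rightarrow> complex \<Rightarrow> riemann_sphere set" where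
  "circle_orbit m z = {Some (exp (of_int j / of_nat m * 2 * of_real pi * \<i>) * z) | j :: int. True}"

definition blocks :: "nat \<Rightarrow> riemann_sphere set set" where
  "blocks m = {{None}, {Some 0}} \<union> {circle_orbit m z | z. z \<noteq> 0}"

text \<open>
  The dihedral group of order \<open>2 m\<close> as the semidirect product of \<open>\<int>/m\<close> and \<open>\<int>/2\<close>: the pair
  \<open>(a, s)\<close> stands for \<open>r\<^sup>a\<close> if \<open>s\<close> is false and for \<open>r\<^sup>a t\<close> if \<open>s\<close> is true, where \<open>t r t = r\<^sup>-\<^sup>1\<close>.
  For \<open>m = 2\<close> this is the Klein four-group, which the symmetries of a degenerate 2-gon, viewed as
  permutations of its vertices, would not give.
\<close>

definition dihedral_group :: "nat \<Rightarrow> (int \<times> bool) monoid" where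
  "dihedral_group m =
     \<lparr>carrier = {0..<int m} \<times> UNIV,
      monoid.mult = (\<lambda>(a, s) (b, t). ((a + (if s then - b else b)) mod int m, s \<noteq> t)),
      one = (0, False)\<rparr>"

lemma moebius_comp:
  assumes "a * d - b * c \<noteq> 0" "a' * d' - b' * c' \<noteq> 0"
  shows "moebius a b c d \<circ> moebius a' b' c' d' =
    moebius (a * a' + b * c') (a * b' + b * d') (c * a' + d * c') (c * b' + d * d')"
proof
  fix x :: riemann_sphere
  have frac: "(if c * (u / v) + d = 0 then None else Some ((a * (u / v) + b) / (c * (u / v) + d)))
      = (if c * u + d * v = 0 then None else Some ((a * u + b * v) / (c * u + d * v)))"
    if "v \<noteq> 0" for u v :: complex
  proof -
    have "c * (u / v) + d = (c * u + d * v) / v" "a * (u / v) + b = (a * u + b * v) / v"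
      using that by (simp_all add: field_simps)
    with that show ?thesis by simp
  qed
  show "(moebius a b c d \<circ> moebius a' b' c' d') x =
    moebius (a * a' + b * c') (a * b' + b * d') (c * a' + d * c') (c * b' + d * d') x"
  proof (cases x)
    case None
    show ?thesis
    proof (cases "c' = 0")
      case True
      then show ?thesis using None assms by auto
    next
      case False
      then show ?thesis using None frac[of c' a'] by simp
    qed
  next
    case (Some z)
    let ?u = "a' * z + b'" and ?v = "c' * z + d'"
    have lin: "(c * a' + d * c') * z + (c * b' + d * d') = c * ?u + d * ?v"
      "(a * a' + b * c') * z + (a * b' + b * d') = a * ?u + b * ?v"
      by (simp_all add: algebra_simps)
    show ?thesis
    proof (cases "?v = 0")
      case True
      have "?u \<noteq> 0"
      proof
        assume u: "?u = 0"
        have "a' * d' - b' * c' = a' * ?v - c' * ?u" "(a' * d' - b' * c') * z = d' * ?u - b' * ?v"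
          by (simp_all add: algebra_simps)
        with u True assms show False by simp
      qed
      with True show ?thesis by (simp add: Some lin)
    next
      case False
      then show ?thesis using frac[of ?v ?u] by (simp add: Some lin)
    qed
  qed
qed

lemma moebius_scale:
  assumes "k \<noteq> 0"
  shows "moebius (k * a) (k * b) (k * c) (k * d) = moebius a b c d"
proof
  fix x
  have "k * c * z + k * d = k * (c * z + d)" "k * a * z + k * b = k * (a * z + b)" for z
    by (simp_all add: algebra_simps)
  with assms show "moebius (k * a) (k * b) (k * c) (k * d) x = moebius a b c d x"
    by (cases x) simp_all
qed

lemma moebius_id: "moebius 1 0 0 1 = id"
proof
  show "moebius 1 0 0 1 x = id x" for x by (cases x) simp_all
qed

lemma moebius_in_moebius_group:
  "a * d - b * c \<noteq> 0 \<Longrightarrow> moebius a b c d \<in> carrier moebius_group"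
  by (auto simp: moebius_group_def)

lemma group_moebius_group: "group moebius_group"
proof (rule groupI)
  fix f g assume "f \<in> carrier moebius_group" "g \<in> carrier moebius_group"
  then obtain a b c d a' b' c' d' where fg: "f = moebius a b c d" "g = moebius a' b' c' d'"
    and nz: "a * d - b * c \<noteq> 0" "a' * d' - b' * c' \<noteq> 0"
    by (auto simp: moebius_group_def)
  have "(a * a' + b * c') * (c * b' + d * d') - (a * b' + b * d') * (c * a' + d * c')
      = (a * d - b * c) * (a' * d' - b' * c')"
    by (simp add: algebra_simps)
  with nz have "(a * a' + b * c') * (c * b' + d * d') - (a * b' + b * d') * (c * a' + d * c') \<noteq> 0"
    by simp
  then show "f \<otimes>\<^bsub>moebius_group\<^esub> g \<in> carrier moebius_group"
    unfolding fg by (simp add: moebius_group_def moebius_comp[OF nz]) blast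
next
  show "\<one>\<^bsub>moebius_group\<^esub> \<in> carrier moebius_group"
    using moebius_in_moebius_group[of 1 1 0 0] moebius_id by (simp add: moebius_group_def)
next
  fix f assume "f \<in> carrier moebius_group"
  then obtain a b c d where f: "f = moebius a b c d" and nz: "a * d - b * c \<noteq> 0"
    by (auto simp: moebius_group_def)
  have nz': "d * a - (- b) * (- c) \<noteq> 0" using nz by (simp add: mult.commute)
  have "moebius d (- b) (- c) a \<circ> f = moebius (d * a - b * c) 0 0 (d * a - b * c)"
    unfolding f by (simp add: moebius_comp[OF nz' nz] algebra_simps)
  also have "\<dots> = id"
    using moebius_scale[of "d * a - b * c" 1 0 0 1] nz moebius_id by (simp add: mult.commute)
  finally show "\<exists>g\<in>carrier moebius_group. g \<otimes>\<^bsub>moebius_group\<^esub> f = \<one>\<^bsub>moebius_group\<^esub>"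
    by (intro bexI[OF _ moebius_in_moebius_group[OF nz']]) (simp add: moebius_group_def)
qed (simp_all add: moebius_group_def comp_assoc)

lemma rotation_in_moebius_group: "rotation n \<in> carrier moebius_group"
proof -
  have "rotation n = moebius (exp (2 * of_real pi * \<i> / of_nat n)) 0 0 1"
  proof
    show "rotation n x = moebius (exp (2 * of_real pi * \<i> / of_nat n)) 0 0 1 x" for x
      by (cases x) (simp_all add: rotation_def)
  qed
  then show ?thesis by (simp add: moebius_in_moebius_group)
qed

lemma group_setwise_stabilizer: "group (setwise_stabilizer \<alpha>)"
proof -
  interpret group moebius_group by (rule group_moebius_group)
  have "subgroup {f \<in> carrier moebius_group. f ` \<alpha> = \<alpha>} moebius_group"
  proof (rule subgroupI)
    fix f assume f: "f \<in> {f \<in> carrier moebius_group. f ` \<alpha> = \<alpha>}"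
    then have "inv\<^bsub>moebius_group\<^esub> f \<circ> f = id"
      using l_inv[of f] by (simp add: moebius_group_def)
    then have "(inv\<^bsub>moebius_group\<^esub> f) ` (f ` \<alpha>) = \<alpha>" by (metis image_comp image_id id_apply)
    with f show "inv\<^bsub>moebius_group\<^esub> f \<in> {f \<in> carrier moebius_group. f ` \<alpha> = \<alpha>}" by simp
  next
    fix f g assume "f \<in> {f \<in> carrier moebius_group. f ` \<alpha> = \<alpha>}"
      "g \<in> {f \<in> carrier moebius_group. f ` \<alpha> = \<alpha>}"
    then show "f \<otimes>\<^bsub>moebius_group\<^esub> g \<in> {f \<in> carrier moebius_group. f ` \<alpha> = \<alpha>}"
      using m_closed[of f g] image_comp[of f g \<alpha>] by (simp add: moebius_group_def)
  next
    have "\<one>\<^bsub>moebius_group\<^esub> \<in> {f \<in> carrier moebius_group. f ` \<alpha> = \<alpha>}"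
      using one_closed by (simp add: moebius_group_def)
    then show "{f \<in> carrier moebius_group. f ` \<alpha> = \<alpha>} \<noteq> {}" by blast
  qed auto
  then show ?thesis unfolding setwise_stabilizer_def by (rule subgroup_imp_group)
qed

lemma group_dihedral_group:
  assumes "m \<ge> 1"
  shows "group (dihedral_group m)"
proof (rule groupI)
  fix x y z
  show "x \<otimes>\<^bsub>dihedral_group m\<^esub> y \<otimes>\<^bsub>dihedral_group m\<^esub> z
      = x \<otimes>\<^bsub>dihedral_group m\<^esub> (y \<otimes>\<^bsub>dihedral_group m\<^esub> z)"
    by (cases x; cases y; cases z) (auto simp: dihedral_group_def mod_simps algebra_simps)
next
  fix x assume x: "x \<in> carrier (dihedral_group m)"
  obtain a s where as: "x = (a, s)" by (cases x)
  have "((if s then a else (- a) mod int m), s) \<in> carrier (dihedral_group m)"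
    using x as assms by (simp add: dihedral_group_def)
  moreover have "((if s then a else (- a) mod int m), s) \<otimes>\<^bsub>dihedral_group m\<^esub> x = \<one>\<^bsub>dihedral_group m\<^esub>"
    using as by (simp add: dihedral_group_def mod_simps)
  ultimately show "\<exists>y\<in>carrier (dihedral_group m). y \<otimes>\<^bsub>dihedral_group m\<^esub> x = \<one>\<^bsub>dihedral_group m\<^esub>"
    by blast
qed (use assms in \<open>auto simp: dihedral_group_def\<close>)

end

theory Submission
  imports Defs
begin

text \<open>
  A set \<open>\<alpha>\<close> is a union of blocks for \<open>m\<close> exactly when it is invariant under multiplication by all
  \<open>m\<close>-th roots of unity (\<open>union_of_blocks_iff\<close>). So the first two conditions say that the
  stabilizer \<open>H\<close> of \<open>\<alpha>\<close> contains the rotation group of order \<open>n\<close>, but for no \<open>p \<ge> 2\<close> the one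
  of order \<open>p n\<close>. If \<open>H\<close> is the rotation group of order \<open>n\<close>, these conditions are immediate, and \<open>H\<close> is
  cyclic, hence none of the groups in the third condition: these are not commutative, except for the
  Klein four-group, in which every square is trivial.

  The converse is Klein's classification of the finite groups of Moebius transformations. Since
  a Moebius transformation is determined by its values at three points, \<open>H\<close> is finite. Only two
  properties of a finite Moebius group enter the classification (locale \<open>two_point_group\<close>): an
  element other than the identity has exactly two fixed points, and the stabilizer of a point is
  cyclic. Both follow by moving a fixed point to \<open>\<infinity>\<close>: an element becomes \<open>z \<mapsto> a z + b\<close>, a
  translation has infinite order, and \<open>a\<close> runs through a finite group of complex numbers.

  Counting pairs of an element and a fixed point of it leaves few possibilities for the
  orbits of points with a nontrivial stabilizer (\<open>pole_orbits\<close>, \<open>orbit_sizes\<close>): either \<open>H\<close> has a common fixed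
  point, or there are three such orbits, with stabilizers of orders \<open>2, 2, m\<close> or \<open>2, 3, 3\<close> or
  \<open>2, 3, 4\<close> or \<open>2, 3, 5\<close>. In these four cases \<open>H\<close> is identified by a small configuration on which it
  acts: a pair of points that it interchanges (dihedral), the four points of an orbit (\<open>A\<^sub>4\<close>), the
  four axes of order 3 (\<open>S\<^sub>4\<close>), the five Klein four-subgroups (\<open>A\<^sub>5\<close>).

  So by the third condition \<open>H\<close> fixes a point. As \<open>H\<close> contains a nontrivial rotation about \<open>0\<close> and
  \<open>\<infinity>\<close>, the fixed point is one of these two, \<open>H\<close> fixes both, and it consists of the multiplications
  by the \<open>N\<close>-th roots of unity for some \<open>N\<close>. The first condition gives \<open>N = p n\<close> and the
  second one \<open>p = 1\<close>.
\<close>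

section \<open>Finite groups of bijections\<close>

definition transformation_monoid :: "('a \<Rightarrow> 'a) set \<Rightarrow> ('a \<Rightarrow> 'a) monoid" where
  "transformation_monoid H = \<lparr>carrier = H, monoid.mult = (\<circ>), one = id\<rparr>"

lemma transformation_monoid_simps [simp]:
  "carrier (transformation_monoid H) = H"
  "f \<otimes>\<^bsub>transformation_monoid H\<^esub> g = f \<circ> g"
  "\<one>\<^bsub>transformation_monoid H\<^esub> = id"
  by (simp_all add: transformation_monoid_def)

locale finite_transformation_group =
  fixes H :: "('a \<Rightarrow> 'a) set"
  assumes finite_H: "finite H"
    and id_mem: "id \<in> H"
    and comp_mem: "f \<in> H \<Longrightarrow> g \<in> H \<Longrightarrow> f \<circ> g \<in> H"
    and bij_mem: "f \<in> H \<Longrightarrow> bij f"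
    and inv_mem: "f \<in> H \<Longrightarrow> inv' f \<in> H"
begin

definition stab :: "'a \<Rightarrow> ('a \<Rightarrow> 'a) set" where
  "stab x = {g \<in> H. g x = x}"

definition orb :: "'a \<Rightarrow> 'a set" where
  "orb x = (\<lambda>g. g x) ` H"

lemma inv_cancel [simp]:
  assumes "f \<in> H"
  shows "inv' f (f x) = x" "f (inv' f x) = x"
  using bij_mem[OF assms] by (simp_all add: bij_is_inj bij_is_surj surj_f_inv_f)

lemma inv_comp [simp]:
  assumes "f \<in> H"
  shows "inv' f \<circ> f = id" "f \<circ> inv' f = id"
  using assms by (auto simp: fun_eq_iff)

lemma apply_eq_iff: "f \<in> H \<Longrightarrow> f x = f y \<longleftrightarrow> x = y"
  by (metis inv_cancel(1))

lemma pow_mem: "f \<in> H \<Longrightarrow> f ^^ k \<in> H"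
  by (induction k) (simp_all add: id_mem comp_mem)

lemma finite_stab: "finite (stab x)"
  using finite_H by (simp add: stab_def)

lemma finite_orb: "finite (orb x)"
  using finite_H by (simp add: orb_def)

lemma orb_self: "x \<in> orb x"
  unfolding orb_def by (rule image_eqI[OF _ id_mem]) simp

lemma orb_closed: "g \<in> H \<Longrightarrow> y \<in> orb x \<Longrightarrow> g y \<in> orb x"
  unfolding orb_def using comp_mem by (metis (no_types, lifting) comp_apply image_iff)

lemma orb_eq:
  assumes "y \<in> orb x"
  shows "orb y = orb x"
proof -
  obtain g where g: "g \<in> H" "y = g x" using assms by (auto simp: orb_def)
  have "x \<in> orb y" unfolding orb_def using g inv_mem[OF g(1)] by (metis image_eqI inv_cancel(1))
  then show ?thesis using assms orb_closed by (auto simp: orb_def)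
qed

text \<open>
  The elements that take \<open>x\<close> to \<open>y\<close> form a coset of the stabilizer of \<open>x\<close>.
\<close>

lemma card_transporter:
  assumes "y \<in> orb x"
  shows "card {h \<in> H. h x = y} = card (stab x)"
proof -
  obtain g where g: "g \<in> H" "y = g x" using assms by (auto simp: orb_def)
  have "bij_betw ((\<circ>) g) (stab x) {h \<in> H. h x = y}"
  proof (rule bij_betwI[where g = "(\<circ>) (inv' g)"])
    show "(\<circ>) g \<in> stab x \<rightarrow> {h \<in> H. h x = y}" "(\<circ>) (inv' g) \<in> {h \<in> H. h x = y} \<rightarrow> stab x"
      using g comp_mem inv_mem by (auto simp: stab_def)
  qed (use g in \<open>auto simp: fun_eq_iff\<close>)
  then show ?thesis by (simp add: bij_betw_same_card)
qed

lemma orbit_stabilizer: "card (orb x) * card (stab x) = card H"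
proof -
  have "card H = (\<Sum>y\<in>orb x. \<Sum>h\<in>{h \<in> H. h x = y}. 1)"
    by (subst sum.group) (auto simp: finite_H finite_orb orb_def)
  also have "\<dots> = (\<Sum>y\<in>orb x. card (stab x))"
    by (rule sum.cong) (auto simp: card_transporter)
  finally show ?thesis by simp
qed

lemma card_stab_pos: "card (stab x) > 0"
  using id_mem finite_stab by (auto simp: card_gt_0_iff stab_def)

lemma card_stab_orb:
  assumes "y \<in> orb x"
  shows "card (stab y) = card (stab x)"
proof -
  have "card (orb x) * card (stab y) = card (orb x) * card (stab x)"
    using orbit_stabilizer[of x] orbit_stabilizer[of y] orb_eq[OF assms] by simp
  moreover have "card (orb x) > 0" using assms finite_orb card_gt_0_iff by blast
  ultimately show ?thesis by simp
qed

lemma conj_mem: "g \<in> H \<Longrightarrow> h \<in> H \<Longrightarrow> g \<circ> h \<circ> inv' g \<in> H"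
  by (simp add: comp_mem inv_mem)

text \<open>
  Numbering the elements of \<open>S\<close> turns a faithful action into an injective homomorphism into the
  symmetric group. The action is given by a function because the three uses differ: on points, on
  sets of points by images, and on sets of group elements by conjugation.
\<close>

lemma faithful_action_embeds:
  fixes act :: "('a \<Rightarrow> 'a) \<Rightarrow> 'b \<Rightarrow> 'b"
  assumes S: "finite S" "card S = n"
    and closed: "\<And>g x. g \<in> H \<Longrightarrow> x \<in> S \<Longrightarrow> act g x \<in> S"
    and act_id: "\<And>x. x \<in> S \<Longrightarrow> act id x = x"
    and act_comp: "\<And>g h x. g \<in> H \<Longrightarrow> h \<in> H \<Longrightarrow> x \<in> S \<Longrightarrow> act (g \<circ> h) x = act g (act h x)"
    and faithful: "\<And>g. g \<in> H \<Longrightarrow> (\<And>x. x \<in> S \<Longrightarrow> act g x = x) \<Longrightarrow> g = id"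
  obtains \<psi> where "\<And>g. g \<in> H \<Longrightarrow> \<psi> g permutes {1..n}"
    and "\<And>g h. g \<in> H \<Longrightarrow> h \<in> H \<Longrightarrow> \<psi> (g \<circ> h) = \<psi> g \<circ> \<psi> h"
    and "inj_on \<psi> H"
proof -
  obtain \<beta> where \<beta>: "bij_betw \<beta> {1..n} S"
    using S ex_bij_betw_nat_finite_1 by blast
  define \<gamma> where "\<gamma> = the_inv_into {1..n} \<beta>"
  have \<gamma>: "\<gamma> x \<in> {1..n}" "\<beta> (\<gamma> x) = x" if "x \<in> S" for x
    using that \<beta> unfolding \<gamma>_def bij_betw_def
    by (auto simp: f_the_inv_into_f intro!: the_inv_into_into[of \<beta> "{1..n}", OF _ _ subset_refl, simplified])
  have \<gamma>': "\<gamma> (\<beta> i) = i" "\<beta> i \<in> S" if "i \<in> {1..n}" for i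
    using that \<beta> unfolding \<gamma>_def bij_betw_def by (auto simp: the_inv_into_f_f)
  define \<psi> where "\<psi> g i = (if i \<in> {1..n} then \<gamma> (act g (\<beta> i)) else i)" for g i
  have \<psi>_in: "\<psi> g i \<in> {1..n}" if "g \<in> H" "i \<in> {1..n}" for g i
    using that \<gamma>(1)[OF closed[OF that(1) \<gamma>'(2)[OF that(2)]]] by (simp add: \<psi>_def)
  have comp: "\<psi> (g \<circ> h) = \<psi> g \<circ> \<psi> h" if "g \<in> H" "h \<in> H" for g h
  proof
    fix i
    show "\<psi> (g \<circ> h) i = (\<psi> g \<circ> \<psi> h) i"
    proof (cases "i \<in> {1..n}")
      case True
      have im: "act h (\<beta> i) \<in> S" using closed that(2) \<gamma>'(2)[OF True] by blast
      have "(\<psi> g \<circ> \<psi> h) i = \<psi> g (\<gamma> (act h (\<beta> i)))"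
        using True by (simp add: \<psi>_def)
      also have "\<dots> = \<gamma> (act g (act h (\<beta> i)))"
        using \<gamma>[OF im] by (simp add: \<psi>_def)
      also have "\<dots> = \<psi> (g \<circ> h) i"
        using act_comp that \<gamma>'(2)[OF True] True by (simp add: \<psi>_def)
      finally show ?thesis by simp
    qed (auto simp: \<psi>_def)
  qed
  have id: "\<psi> id = id" using act_id \<gamma>' by (auto simp: \<psi>_def)
  have "\<psi> g permutes {1..n}" if g: "g \<in> H" for g
  proof (rule bij_imp_permutes)
    have inv: "\<psi> g \<circ> \<psi> (inv' g) = id" "\<psi> (inv' g) \<circ> \<psi> g = id"
      using comp[OF g inv_mem[OF g]] comp[OF inv_mem[OF g] g] g id by simp_all
    show "bij_betw (\<psi> g) {1..n} {1..n}"
      by (rule bij_betwI[where g = "\<psi> (inv' g)"])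
        (use inv \<psi>_in g inv_mem[OF g] in \<open>auto simp: fun_eq_iff\<close>)
  qed (simp only: \<psi>_def if_False)
  moreover have "inj_on \<psi> H"
  proof (rule inj_onI)
    fix g h assume gh: "g \<in> H" "h \<in> H" "\<psi> g = \<psi> h"
    have "\<psi> (inv' h \<circ> g) = \<psi> (inv' h \<circ> h)"
      using gh comp[OF inv_mem[OF gh(2)]] by metis
    then have "\<psi> (inv' h \<circ> g) = id" using gh id by simp
    moreover have k: "inv' h \<circ> g \<in> H" using gh comp_mem inv_mem by blast
    ultimately have "\<gamma> (act (inv' h \<circ> g) x) = \<gamma> x" if "x \<in> S" for x
      using \<gamma>[OF that] by (metis \<psi>_def id_apply)
    then have "act (inv' h \<circ> g) x = x" if "x \<in> S" for x
      using \<gamma>(2)[OF that] \<gamma>(2)[OF closed[OF k that]] that by metis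
    then have "inv' h \<circ> g = id" using faithful[OF k] by blast
    then have "inv' h (g x) = x" for x by (metis comp_apply id_apply)
    then show "g = h" using gh(2) by (metis inv_cancel(2) ext)
  qed
  ultimately show ?thesis using comp that by blast
qed

lemma iso_sym_group:
  assumes perm: "\<And>g. g \<in> H \<Longrightarrow> \<psi> g permutes {1..n}"
    and comp: "\<And>g h. g \<in> H \<Longrightarrow> h \<in> H \<Longrightarrow> \<psi> (g \<circ> h) = \<psi> g \<circ> \<psi> h"
    and inj: "inj_on \<psi> H" and card: "card H = fact n"
  shows "transformation_monoid H \<cong> sym_group n"
proof -
  have "\<psi> ` H = carrier (sym_group n)"
  proof (rule card_subset_eq)
    show "finite (carrier (sym_group n))"
      unfolding sym_group_def using finite_permutations[of "{1..n}"] by simp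
    show "\<psi> ` H \<subseteq> carrier (sym_group n)" using perm by (auto simp: sym_group_carrier)
    show "card (\<psi> ` H) = card (carrier (sym_group n))"
      using card inj by (simp add: card_image sym_group_card_carrier)
  qed
  then show ?thesis
    using comp inj perm by (intro is_isoI isoI) (auto simp: hom_def bij_betw_def sym_group_mult)
qed

lemma iso_alt_group:
  assumes n: "n \<ge> 2"
    and perm: "\<And>g. g \<in> H \<Longrightarrow> \<psi> g permutes {1..n}"
    and comp: "\<And>g h. g \<in> H \<Longrightarrow> h \<in> H \<Longrightarrow> \<psi> (g \<circ> h) = \<psi> g \<circ> \<psi> h"
    and inj: "inj_on \<psi> H" and card: "2 * card H = fact n"
    and even: "\<And>g. g \<in> H \<Longrightarrow> evenperm (\<psi> g)"
  shows "transformation_monoid H \<cong> alt_group n"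
proof -
  have "\<psi> ` H = carrier (alt_group n)"
  proof (rule card_subset_eq)
    show "finite (carrier (alt_group n))"
      unfolding alt_group_def using finite_permutations[of "{1..n}"] by simp
    show "\<psi> ` H \<subseteq> carrier (alt_group n)" using perm even by (auto simp: alt_group_carrier)
    show "card (\<psi> ` H) = card (carrier (alt_group n))"
      using card inj n alt_group_card_carrier[of n] by (simp add: card_image)
  qed
  then show ?thesis
    using comp inj perm by (intro is_isoI isoI) (auto simp: hom_def bij_betw_def alt_group_mult)
qed

text \<open>
  An odd permutation in the image would give a translation that carries the elements acting
  evenly injectively to those acting oddly, so that the former make up at most half of the group.
\<close>

lemma evenperm_half:
  assumes perm: "\<And>g. g \<in> H \<Longrightarrow> permutation (\<psi> g)"
    and comp: "\<And>g h. g \<in> H \<Longrightarrow> h \<in> H \<Longrightarrow> \<psi> (g \<circ> h) = \<psi> g \<circ> \<psi> h"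
    and more: "card H < 2 * card {g \<in> H. evenperm (\<psi> g)}"
    and g: "g \<in> H"
  shows "evenperm (\<psi> g)"
proof (rule ccontr)
  assume odd: "\<not> evenperm (\<psi> g)"
  let ?K = "{g \<in> H. evenperm (\<psi> g)}"
  have "(\<circ>) g ` ?K \<subseteq> H - ?K"
    using odd g perm comp by (auto simp: comp_mem evenperm_comp)
  moreover have "inj_on ((\<circ>) g) ?K"
    using g by (auto simp: inj_on_def fun_eq_iff apply_eq_iff)
  ultimately have "card ?K \<le> card (H - ?K)"
    using card_inj_on_le finite_H by blast
  also have "\<dots> = card H - card ?K"
    using finite_H by (intro card_Diff_subset) auto
  finally show False using more by linarith
qed

end

section \<open>Groups whose nontrivial elements have two fixed points\<close>

text \<open>
  The abstract setting of the classification. Everything up to the isomorphism types is deduced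
  from these two properties, without reference to the complex numbers.
\<close>

locale two_point_group = finite_transformation_group +
  assumes two_fixed: "f \<in> H \<Longrightarrow> f \<noteq> id \<Longrightarrow> card {x. f x = x} = 2"
    and cyclic_stab: "\<exists>r. r ^^ card (stab x) = id \<and> stab x = range (\<lambda>k. r ^^ k)"
begin

lemma finite_fixed: "f \<in> H \<Longrightarrow> f \<noteq> id \<Longrightarrow> finite {x. f x = x}"
  using two_fixed[of f] by (intro card_ge_0_finite) simp

lemma eq_id_if_three_fixed:
  assumes "f \<in> H" "S \<subseteq> {x. f x = x}" "card S > 2"
  shows "f = id"
  using assms card_mono[OF finite_fixed assms(2)] two_fixed by fastforce

lemma stab_commute:
  assumes "g \<in> stab x" "h \<in> stab x"
  shows "g \<circ> h = h \<circ> g"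
proof -
  obtain r where "stab x = range (\<lambda>k. r ^^ k)" using cyclic_stab by blast
  then obtain i j where "g = r ^^ i" "h = r ^^ j" using assms by blast
  then show ?thesis by (metis add.commute funpow_add)
qed

lemma stab_pow_card:
  assumes "h \<in> stab x"
  shows "h ^^ card (stab x) = id"
proof -
  obtain r where r: "r ^^ card (stab x) = id" "stab x = range (\<lambda>k. r ^^ k)"
    using cyclic_stab by blast
  then obtain i where "h = r ^^ i" using assms by blast
  then have "h ^^ card (stab x) = (r ^^ card (stab x)) ^^ i"
    by (simp add: funpow_mult mult.commute)
  then show ?thesis using r(1) by simp
qed

text \<open>
  The stabilizer of a point is commutative, so each of its elements permutes the two fixed points
  of \<open>g\<close>; as it fixes one of them, it fixes the other. Hence the points with a nontrivial stabilizer
  come in pairs with the same stabilizer, the poles of an axis.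
\<close>

lemma stab_eq:
  assumes g: "g \<in> H" "g \<noteq> id" "g x = x" "g y = y"
  shows "stab x = stab y"
proof (cases "x = y")
  case False
  have fixed: "{z. g z = z} = {x, y}"
    using False g two_fixed[OF g(1,2)] finite_fixed[OF g(1,2)]
    by (intro card_subset_eq[symmetric]) auto
  have "h z = z" if h: "h \<in> stab w" and w: "{w, z} = {x, y}" for h w z
  proof -
    have "g \<in> stab w" using w g by (auto simp: stab_def doubleton_eq_iff)
    then have "g (h z) = h (g z)" using stab_commute[OF h] by (metis comp_apply)
    then have "g (h z) = h z" using w g by (auto simp: doubleton_eq_iff)
    then have "h z \<in> {w, z}" using fixed w by blast
    moreover have "w \<noteq> z" using w False by (auto simp: doubleton_eq_iff)
    then have "h z \<noteq> w" using h apply_eq_iff[of h z w] by (auto simp: stab_def)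
    ultimately show ?thesis by blast
  qed
  from this[of _ x y] this[of _ y x] show ?thesis
    by (auto simp: stab_def insert_commute)
qed simp

lemma card_same_stab:
  assumes "1 < card (stab x)"
  shows "card {y. stab y = stab x} = 2"
proof -
  have "\<not> stab x \<subseteq> {id}"
    using assms card_mono[of "{id}" "stab x"] by auto
  then obtain g where g: "g \<in> stab x" "g \<noteq> id" by blast
  then have "{y. stab y = stab x} = {y. g y = y}"
    using stab_eq[of g] by (auto simp: stab_def)
  then show ?thesis using g two_fixed by (simp add: stab_def)
qed

text \<open>
  Otherwise \<open>f \<circ> f\<close> would fix four points: \<open>x\<close>, \<open>y\<close> and the two fixed points of \<open>f\<close>.
\<close>

lemma swap_involution:
  assumes f: "f \<in> H" "f x = y" "f y = x" "x \<noteq> y"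
  shows "f \<circ> f = id"
proof (rule eq_id_if_three_fixed)
  have id: "f \<noteq> id" using f by auto
  show "f \<circ> f \<in> H" using f comp_mem by blast
  show "{z. f z = z} \<union> {x, y} \<subseteq> {z. (f \<circ> f) z = z}" using f by auto
  have "{z. f z = z} \<inter> {x, y} = {}" using f by auto
  then show "card ({z. f z = z} \<union> {x, y}) > 2"
    using two_fixed[OF f(1) id] finite_fixed[OF f(1) id] f by (simp add: card_Un_disjoint)
qed

definition poles :: "'a set" where
  "poles = {x. 1 < card (stab x)}"

lemma poles_iff: "x \<in> poles \<longleftrightarrow> (\<exists>g\<in>H. g \<noteq> id \<and> g x = x)"
proof
  assume "x \<in> poles"
  then have "\<not> stab x \<subseteq> {id}"
    using card_mono[of "{id}" "stab x"] by (auto simp: poles_def)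
  then show "\<exists>g\<in>H. g \<noteq> id \<and> g x = x" by (auto simp: stab_def)
next
  assume "\<exists>g\<in>H. g \<noteq> id \<and> g x = x"
  then obtain g where g: "{id, g} \<subseteq> stab x" "g \<noteq> id"
    using id_mem by (auto simp: stab_def)
  then show "x \<in> poles"
    using card_mono[OF finite_stab g(1)] by (auto simp: poles_def)
qed

lemma finite_poles: "finite poles"
proof -
  have "poles = (\<Union>g\<in>H - {id}. {x. g x = x})" by (auto simp: poles_iff)
  then show ?thesis using finite_H finite_fixed by auto
qed

text \<open>
  Pairs of a nontrivial element of \<open>K\<close> and a fixed point of it, counted in two ways. For \<open>K = H\<close>
  this gives the class equation; for the subgroup of elements that act as even permutations it shows
  that the subgroup is large.
\<close>

lemma pole_count:
  assumes "K \<subseteq> H" "id \<in> K"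
  shows "(\<Sum>x\<in>poles. card (stab x \<inter> K) - 1) = 2 * (card K - 1)"
proof -
  have fin: "finite K" using assms finite_H finite_subset by blast
  have "(\<Sum>x\<in>poles. card {g \<in> K - {id}. g x = x}) = (\<Sum>g\<in>K - {id}. 2)"
  proof (rule sum_multicount_gen)
    show "\<forall>g\<in>K - {id}. card {x \<in> poles. g x = x} = 2"
    proof
      fix g assume g: "g \<in> K - {id}"
      then have "{x \<in> poles. g x = x} = {x. g x = x}" using assms by (auto simp: poles_iff)
      then show "card {x \<in> poles. g x = x} = 2" using g assms two_fixed by auto
    qed
  qed (use fin finite_poles in auto)
  moreover have "card {g \<in> K - {id}. g x = x} = card (stab x \<inter> K) - 1" for x
  proof -
    have "{g \<in> K - {id}. g x = x} = (stab x \<inter> K) - {id}" using assms by (auto simp: stab_def)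
    then show ?thesis using assms id_mem by (simp add: stab_def)
  qed
  ultimately show ?thesis using assms fin by simp
qed

lemma orb_subset_poles:
  assumes "x \<in> poles"
  shows "orb x \<subseteq> poles"
  using assms card_stab_orb by (auto simp: poles_def)

lemma orb_weight: "card (orb x) * (card (stab x) - 1) = card H - card (orb x)"
  using orbit_stabilizer[of x] by (simp add: diff_mult_distrib2)

text \<open>
  An orbit with stabilizers of order \<open>e\<close> contributes \<open>card Q * (e - 1) = card H - card Q\<close> to the count.
  Division by \<open>card H\<close> gives the familiar form, in which the numbers \<open>1 - 1 / e\<close> add up
  to \<open>2 - 2 / card H\<close>.
\<close>

lemma class_equation: "(\<Sum>Q\<in>orb ` poles. card H - card Q) = 2 * (card H - 1)"
proof -
  have "2 * (card H - 1) = (\<Sum>x\<in>poles. card (stab x) - 1)"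
    using pole_count[of H] id_mem by (simp add: stab_def Int_absorb2 Collect_conj_eq[symmetric])
  also have "\<dots> = (\<Sum>Q\<in>orb ` poles. \<Sum>x\<in>{x \<in> poles. orb x = Q}. card (stab x) - 1)"
    by (rule sum.group[symmetric]) (auto simp: finite_poles)
  also have "\<dots> = (\<Sum>Q\<in>orb ` poles. card H - card Q)"
  proof (rule sum.cong[OF refl])
    fix Q assume "Q \<in> orb ` poles"
    then obtain y where y: "y \<in> poles" "Q = orb y" by blast
    have "{x \<in> poles. orb x = Q} = orb y"
      using y orb_subset_poles[OF y(1)] orb_eq orb_self by blast
    then have "(\<Sum>x\<in>{x \<in> poles. orb x = Q}. card (stab x) - 1) = (\<Sum>x\<in>orb y. card (stab y) - 1)"
      using card_stab_orb by (intro sum.cong) auto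
    then show "(\<Sum>x\<in>{x \<in> poles. orb x = Q}. card (stab x) - 1) = card H - card Q"
      using orb_weight y by simp
  qed
  finally show ?thesis by simp
qed

lemma card_orb_pos: "card (orb x) > 0"
  using finite_orb orb_self card_gt_0_iff by blast

text \<open>
  Every term of the class equation is at least half of \<open>card H\<close> and less than \<open>card H\<close>, while
  the sum is \<open>2 * card H - 2\<close>: this forces two or three orbits. Two orbits have two points altogether,
  so each of them is a single common fixed point. The three orbits are ordered by the order of
  their stabilizers.
\<close>

lemma pole_orbits:
  assumes N: "card H \<ge> 2"
  obtains x where "stab x = H"
  | x y z where "poles = orb x \<union> orb y \<union> orb z"
      "orb x \<inter> orb y = {}" "orb x \<inter> orb z = {}" "orb y \<inter> orb z = {}"
      "2 \<le> card (stab x)" "card (stab x) \<le> card (stab y)" "card (stab y) \<le> card (stab z)"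
      "card (orb x) + card (orb y) + card (orb z) = card H + 2"
proof -
  note three_orbits = that(2)
  define W where "W = orb ` poles"
  define k where "k = card W"
  have finW: "finite W" using finite_poles by (simp add: W_def)
  have half: "2 * card Q \<le> card H" "card Q \<ge> 1" if Q: "Q \<in> W" for Q
  proof -
    obtain x where x: "x \<in> poles" "Q = orb x" using Q unfolding W_def by blast
    then have "card Q * 2 \<le> card Q * card (stab x)"
      by (intro mult_le_mono) (auto simp: poles_def)
    then show "2 * card Q \<le> card H" "card Q \<ge> 1"
      using orbit_stabilizer[of x] card_orb_pos[of x] x by simp_all
  qed
  have eq: "(\<Sum>Q\<in>W. card H - card Q) = 2 * (card H - 1)"
    using class_equation by (simp add: W_def)
  have "(\<Sum>Q\<in>W. card H - card Q) + (\<Sum>Q\<in>W. card Q) = (\<Sum>Q\<in>W. card H)"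
    unfolding sum.distrib[symmetric]
  proof (rule sum.cong[OF refl])
    show "card H - card Q + card Q = card H" if "Q \<in> W" for Q using half[OF that] by linarith
  qed
  then have tot: "2 * (card H - 1) + (\<Sum>Q\<in>W. card Q) = k * card H"
    using eq by (simp add: k_def)
  have "2 * (\<Sum>Q\<in>W. card Q) \<le> (\<Sum>Q\<in>W. card H)"
    unfolding sum_distrib_left using half by (intro sum_mono) auto
  then have up: "2 * (\<Sum>Q\<in>W. card Q) \<le> k * card H" by (simp add: k_def)
  have "(\<Sum>Q\<in>W. 1) \<le> (\<Sum>Q\<in>W. card Q)" using half by (intro sum_mono) auto
  then have low: "k \<le> (\<Sum>Q\<in>W. card Q)" by (simp add: k_def)
  have "k \<noteq> 0" using tot N by (intro notI) simp
  moreover have "k \<noteq> 1" using tot N low by (intro notI) simp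
  moreover have "k < 4"
  proof (rule ccontr)
    assume "\<not> k < 4"
    then have "4 * card H \<le> k * card H" by (intro mult_le_mono1) simp
    then show False using tot up N by linarith
  qed
  ultimately consider "k = 2" | "k = 3" by linarith
  then show ?thesis
  proof cases
    case 1
    then obtain A B where AB: "W = {A, B}" "A \<noteq> B" by (auto simp: k_def card_2_iff)
    have "card A + card B = 2" using tot 1 AB N by simp
    then have "card A = 1" using half[of A] half[of B] AB by auto
    moreover obtain x where "A = orb x" using AB(1) unfolding W_def by blast
    ultimately have "card (stab x) = card H" using orbit_stabilizer[of x] by simp
    then have "stab x = H" by (intro card_subset_eq finite_H) (auto simp: stab_def)
    then show ?thesis by (rule that(1))
  next
    case 3: 2
    have sum3: "(\<Sum>Q\<in>W. card Q) = card H + 2" using tot 3 N by simp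
    \<comment> \<open>The orbits are named so that larger orbits, which have smaller stabilizers, come first.\<close>
    have finish: thesis
      if W: "W = {A, B, C}" "A \<noteq> B" "A \<noteq> C" "B \<noteq> C"
        and le: "card A \<ge> card B" "card B \<ge> card C" for A B C
    proof -
      obtain x y z where xyz: "x \<in> poles" "y \<in> poles" "z \<in> poles"
        "A = orb x" "B = orb y" "C = orb z"
      proof -
        have "A \<in> W" "B \<in> W" "C \<in> W" using W(1) by simp_all
        then show ?thesis using that unfolding W_def by blast
      qed
      have le_stab: "card (stab u) \<le> card (stab v)" if "card (orb v) \<le> card (orb u)" for u v
      proof -
        have "card (orb u) * card (stab u) = card (orb v) * card (stab v)"
          using orbit_stabilizer by metis
        also have "\<dots> \<le> card (orb u) * card (stab v)" using that by (rule mult_le_mono1)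
        finally show ?thesis using card_orb_pos[of u] by simp
      qed
      have disj: "orb u \<inter> orb v = {}" if "orb u \<noteq> orb v" for u v
        using that orb_eq by blast
      show thesis
      proof (rule three_orbits)
        have "poles = \<Union> W"
          using orb_self orb_subset_poles by (fastforce simp: W_def)
        then show "poles = orb x \<union> orb y \<union> orb z" using W xyz by auto
        show "card (orb x) + card (orb y) + card (orb z) = card H + 2"
          using sum3 W xyz by simp
        show "orb x \<inter> orb y = {}" "orb x \<inter> orb z = {}" "orb y \<inter> orb z = {}"
          using W(2-4) xyz by (simp_all add: disj)
        show "card (stab x) \<le> card (stab y)" "card (stab y) \<le> card (stab z)"
          using le xyz by (simp_all add: le_stab)
        show "2 \<le> card (stab x)" using xyz(1) by (simp add: poles_def)
      qed
    qed
    obtain A B C where W: "W = {A, B, C}" "A \<noteq> B" "A \<noteq> C" "B \<noteq> C"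
      using 3 by (auto simp: k_def card_3_iff)
    consider "card A \<ge> card B" "card B \<ge> card C" | "card A \<ge> card C" "card C \<ge> card B"
      | "card B \<ge> card A" "card A \<ge> card C" | "card B \<ge> card C" "card C \<ge> card A"
      | "card C \<ge> card A" "card A \<ge> card B" | "card C \<ge> card B" "card B \<ge> card A"
      by linarith
    moreover have "W = {A, C, B}" "W = {B, A, C}" "W = {B, C, A}" "W = {C, A, B}" "W = {C, B, A}"
      using W(1) by blast+
    moreover note W W(2-4)[symmetric]
    ultimately show ?thesis by cases (metis finish)+
  qed
qed

text \<open>
  These are the solutions of \<open>1 / p + 1 / q + 1 / r = 1 + 2 / N\<close>. The smallest order cannot
  exceed 2, the next one cannot exceed 3, and if it is 3, the last one cannot exceed 5; otherwise the
  three orbits would be too small.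
\<close>

lemma orbit_sizes:
  fixes a b c p q r N :: nat
  assumes N: "a * p = N" "b * q = N" "c * r = N"
    and le: "2 \<le> p" "p \<le> q" "q \<le> r" and sum: "a + b + c = N + 2" and "N > 0"
  shows "p = 2 \<and> q = 2 \<and> c = 2 \<or> p = 2 \<and> q = 3 \<and> r = 3 \<and> N = 12 \<or>
    p = 2 \<and> q = 3 \<and> r = 4 \<and> N = 24 \<or> p = 2 \<and> q = 3 \<and> r = 5 \<and> N = 60"
proof -
  have bd: "k \<le> p \<Longrightarrow> a * k \<le> N" "k \<le> q \<Longrightarrow> b * k \<le> N" "k \<le> r \<Longrightarrow> c * k \<le> N" for k
    using N mult_le_mono2 by metis+
  have p: "p = 2"
  proof (rule ccontr)
    assume "p \<noteq> 2"
    then show False using bd(1)[of 3] bd(2)[of 3] bd(3)[of 3] le sum by linarith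
  qed
  have q: "q < 4"
  proof (rule ccontr)
    assume "\<not> q < 4"
    then show False using bd(2)[of 4] bd(3)[of 4] N(1)[unfolded p] le sum by linarith
  qed
  then consider "q = 2" | "q = 3" using le p by linarith
  then show ?thesis
  proof cases
    case 1
    then show ?thesis using p N sum by auto
  next
    case 2
    have "r < 6"
    proof (rule ccontr)
      assume "\<not> r < 6"
      then show False using bd(3)[of 6] N(1)[unfolded p] N(2)[unfolded 2] \<open>N > 0\<close> sum by linarith
    qed
    then consider "r = 3" | "r = 4" | "r = 5" using le 2 by linarith
    then show ?thesis using p 2 N sum by cases auto
  qed
qed

end

section \<open>The dihedral and the tetrahedral case\<close>

context two_point_group begin

text \<open>
  An element \<open>u\<close> that interchanges the two points of the orbit is an involution, and so is its
  product with every power of the generator \<open>r\<close> of the stabilizer, because that product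
  interchanges the points as well. This is the dihedral relation \<open>u r u = r\<^sup>-\<^sup>1\<close>.
\<close>

lemma iso_dihedral_group:
  assumes orb: "card (orb z) = 2"
  shows "transformation_monoid H \<cong> dihedral_group (card (stab z))"
proof -
  define m where "m = card (stab z)"
  have m: "m > 0" using card_stab_pos by (simp add: m_def)
  obtain w where w: "orb z = {z, w}" "z \<noteq> w"
  proof -
    obtain a b where "orb z = {a, b}" "a \<noteq> b" using orb by (auto simp: card_2_iff)
    moreover from this have "z = a \<or> z = b" using orb_self[of z] by simp
    ultimately show ?thesis using that by (metis insert_commute)
  qed
  obtain u where u: "u \<in> H" "u z = w" using w unfolding orb_def by force
  have swap: "g w = z" if "g \<in> H" "g z = w" for g
    using that orb_closed[OF that(1), of w z] apply_eq_iff[OF that(1), of w z] w by auto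
  have fix_w: "g w = w" if "g \<in> stab z" for g
    using that orb_closed[of g w z] apply_eq_iff[of g w z] w by (auto simp: stab_def)
  have uu: "u \<circ> u = id" using swap_involution[OF u(1) u(2) swap[OF u] w(2)] .
  obtain r where r: "r ^^ m = id" "stab z = range (\<lambda>k. r ^^ k)"
    using cyclic_stab[of z] unfolding m_def by blast
  have r_mod: "r ^^ (k mod m) = r ^^ k" for k
    using funpow_mod_eq[of m r _ k] r(1) by (auto simp: fun_eq_iff)
  \<comment> \<open>Indexing the powers of the generator by all integers makes room for negative exponents.\<close>
  define R where "R a = r ^^ nat (a mod int m)" for a
  have R_comp: "R a \<circ> R b = R (a + b)" for a b
  proof -
    have "nat ((a + b) mod int m) = (nat (a mod int m) + nat (b mod int m)) mod m"
      using m by (simp add: nat_add_distrib[symmetric] nat_mod_as_int mod_simps)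
    then show ?thesis by (simp add: R_def r_mod funpow_add)
  qed
  have R_0: "R 0 = id" by (simp add: R_def)
  have R_mod: "R (a mod int m) = R a" for a by (simp add: R_def)
  have R_stab: "R a \<in> stab z" for a using r(2) by (auto simp: R_def)
  have stab_R: "\<exists>a\<in>{0..<int m}. g = R a" if "g \<in> stab z" for g
  proof -
    obtain k where "g = r ^^ k" using \<open>g \<in> stab z\<close> r(2) by blast
    then have "g = R (int k mod int m)"
      using m r_mod[of k] by (simp add: R_def zmod_int[symmetric])
    then show ?thesis using m by (intro bexI[of _ "int k mod int m"]) auto
  qed
  have R_H: "R a \<in> H" for a using R_stab by (simp add: stab_def)
  have u_R: "u \<circ> R b = R (- b) \<circ> u" for b
  proof -
    have "(u \<circ> R b) z = w" "(u \<circ> R b) w = z"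
      using R_stab[of b] fix_w[OF R_stab[of b]] u swap[OF u] by (auto simp: stab_def)
    then have "(u \<circ> R b) \<circ> (u \<circ> R b) = id"
      using swap_involution[of "u \<circ> R b" z w] w(2) u(1) R_H comp_mem by blast
    then have "((u \<circ> R b) \<circ> (u \<circ> R b)) \<circ> (R (- b) \<circ> u) = R (- b) \<circ> u" by simp
    moreover have "((u \<circ> R b) \<circ> (u \<circ> R b)) \<circ> (R (- b) \<circ> u)
        = (u \<circ> R b) \<circ> u \<circ> (R b \<circ> R (- b)) \<circ> u" by (simp only: comp_assoc)
    ultimately show ?thesis using uu by (simp add: R_comp R_0 comp_assoc)
  qed
  define \<Phi> where "\<Phi> x = (case x of (a, s) \<Rightarrow> R a \<circ> (if s then u else id))" for x
  let ?D = "dihedral_group m"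
  have D: "carrier ?D = {0..<int m} \<times> UNIV" by (simp add: dihedral_group_def)
  have image: "\<Phi> ` carrier ?D = H"
  proof
    show "\<Phi> ` carrier ?D \<subseteq> H" using R_H u(1) comp_mem by (auto simp: D \<Phi>_def)
    show "H \<subseteq> \<Phi> ` carrier ?D"
    proof
      fix g assume g: "g \<in> H"
      then have "g z \<in> {z, w}" using w(1) by (auto simp: orb_def)
      then consider "g z = z" | "g z = w" by blast
      then show "g \<in> \<Phi> ` carrier ?D"
      proof cases
        case 1
        then obtain a where "a \<in> {0..<int m}" "g = R a"
          using g stab_R[of g] by (auto simp: stab_def)
        then show ?thesis by (intro image_eqI[of _ _ "(a, False)"]) (auto simp: D \<Phi>_def)
      next
        case 2
        then have "g \<circ> u \<in> stab z" using g u swap comp_mem by (simp add: stab_def)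
        then obtain a where a: "a \<in> {0..<int m}" "g \<circ> u = R a" using stab_R by blast
        have "g = (g \<circ> u) \<circ> u" using uu by (simp add: comp_assoc)
        then have "g = R a \<circ> u" by (simp only: a(2))
        then show ?thesis using a(1) by (intro image_eqI[of _ _ "(a, True)"]) (auto simp: D \<Phi>_def)
      qed
    qed
  qed
  have "card (carrier ?D) = 2 * m" by (simp add: D card_cartesian_product)
  then have "card H = card (carrier ?D)"
    using orbit_stabilizer[of z] orb by (simp add: m_def)
  then have inj: "inj_on \<Phi> (carrier ?D)"
    using image by (intro eq_card_imp_inj_on) (auto simp: D)
  have "\<Phi> \<in> iso ?D (transformation_monoid H)"
  proof (rule isoI)
    show "bij_betw \<Phi> (carrier ?D) (carrier (transformation_monoid H))"
      using inj image by (simp add: bij_betw_def)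
    show "\<Phi> \<in> hom ?D (transformation_monoid H)"
    proof (rule homI)
      fix x y :: "int \<times> bool"
      obtain a s b t where xy: "x = (a, s)" "y = (b, t)" by (metis surj_pair)
      have mult: "x \<otimes>\<^bsub>?D\<^esub> y = ((a + (if s then - b else b)) mod int m, s \<noteq> t)"
        by (simp add: xy dihedral_group_def)
      have \<Phi>_mult: "\<Phi> (x \<otimes>\<^bsub>?D\<^esub> y)
          = R (a + (if s then - b else b)) \<circ> (if s \<noteq> t then u else id)"
        unfolding mult by (simp add: \<Phi>_def R_mod)
      show "\<Phi> (x \<otimes>\<^bsub>?D\<^esub> y) = \<Phi> x \<otimes>\<^bsub>transformation_monoid H\<^esub> \<Phi> y"
      proof (cases s)
        case False
        then have "\<Phi> x \<circ> \<Phi> y = R (a + b) \<circ> (if t then u else id)"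
          by (simp add: xy \<Phi>_def R_comp comp_assoc[symmetric])
        then show ?thesis using False by (simp add: \<Phi>_mult)
      next
        case True
        have "\<Phi> x \<circ> \<Phi> y = R a \<circ> (u \<circ> R b) \<circ> (if t then u else id)"
          using True by (simp add: xy \<Phi>_def comp_assoc)
        also have "\<dots> = R (a - b) \<circ> (u \<circ> (if t then u else id))"
          by (simp add: u_R comp_assoc[symmetric] R_comp)
        also have "\<dots> = \<Phi> (x \<otimes>\<^bsub>?D\<^esub> y)"
          using True uu by (simp add: \<Phi>_mult)
        finally show ?thesis by simp
      qed
    qed (use image in auto)
  qed
  then have "?D \<cong> transformation_monoid H" by (rule is_isoI)
  then show ?thesis
    using group.iso_sym group_dihedral_group[of m] m by (simp add: m_def)
qed

text \<open>
  The order of \<open>g\<close> is odd, so its sign is an odd root of 1.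
\<close>

lemma evenperm_odd_stab:
  assumes perm: "\<And>g. g \<in> H \<Longrightarrow> permutation (\<psi> g)"
    and comp: "\<And>g h. g \<in> H \<Longrightarrow> h \<in> H \<Longrightarrow> \<psi> (g \<circ> h) = \<psi> g \<circ> \<psi> h"
    and g: "g \<in> stab x" and odd: "odd (card (stab x))"
  shows "evenperm (\<psi> g)"
proof -
  have gH: "g \<in> H" using g by (simp add: stab_def)
  have sgn: "sign (\<psi> (g \<circ> h)) = sign (\<psi> g) * sign (\<psi> h)" if "h \<in> H" for h
    using comp[OF gH that] sign_compose[OF perm[OF gH] perm[OF that]] by simp
  have "sign (\<psi> g) = sign (\<psi> g) * sign (\<psi> id)" using sgn[OF id_mem] by simp
  then have id: "sign (\<psi> id) = 1" by simp
  have "sign (\<psi> (g ^^ k)) = sign (\<psi> g) ^ k" for k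
  proof (induction k)
    case (Suc k)
    then show ?case using sgn[OF pow_mem[OF gH, of k]] by (simp only: funpow.simps(2) power_Suc)
  qed (simp only: funpow.simps(1) id power_0)
  from this[of "card (stab x)"] have "sign (\<psi> g) ^ card (stab x) = 1"
    using stab_pow_card[OF g] id by simp
  with odd show ?thesis by (cases "evenperm (\<psi> g)") (simp_all add: sign_def)
qed

text \<open>
  Stabilizers of odd order act evenly. Two orbits of poles with such stabilizers of order at
  least 3 already account for more than half of the group: they contribute at least
  \<open>card H - card H / 3\<close> each to the pole count of the even elements.
\<close>

lemma evenperm_two_odd_orbits:
  assumes perm: "\<And>g. g \<in> H \<Longrightarrow> permutation (\<psi> g)"
    and comp: "\<And>g h. g \<in> H \<Longrightarrow> h \<in> H \<Longrightarrow> \<psi> (g \<circ> h) = \<psi> g \<circ> \<psi> h"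
    and yz: "y \<in> poles" "z \<in> poles" "orb y \<inter> orb z = {}"
    and odd: "odd (card (stab y))" "odd (card (stab z))"
    and g: "g \<in> H"
  shows "evenperm (\<psi> g)"
proof (rule evenperm_half[where \<psi> = \<psi>, OF perm comp _ g])
  let ?K = "{g \<in> H. evenperm (\<psi> g)}"
  have weight: "(\<Sum>p\<in>orb x. card (stab p \<inter> ?K) - 1) = card H - card (orb x)"
    "3 * card (orb x) \<le> card H"
    if x: "x \<in> poles" "odd (card (stab x))" for x
  proof -
    have "stab p \<inter> ?K = stab p" if "p \<in> orb x" for p
      using evenperm_odd_stab[where \<psi> = \<psi> and x = p, OF perm comp] card_stab_orb[OF that] x(2)
      by (auto simp: stab_def)
    then have "(\<Sum>p\<in>orb x. card (stab p \<inter> ?K) - 1) = (\<Sum>p\<in>orb x. card (stab x) - 1)"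
      by (intro sum.cong) (auto simp: card_stab_orb)
    then show "(\<Sum>p\<in>orb x. card (stab p \<inter> ?K) - 1) = card H - card (orb x)"
      using orb_weight[of x] by simp
    have "card (stab x) \<noteq> 2" "1 < card (stab x)" using x by (auto simp: poles_def)
    then have "card (orb x) * 3 \<le> card (orb x) * card (stab x)" by (intro mult_le_mono2) linarith
    then show "3 * card (orb x) \<le> card H" by (simp add: orbit_stabilizer)
  qed
  have "id \<in> stab y" "id \<in> H" using id_mem by (auto simp: stab_def)
  then have id: "evenperm (\<psi> id)"
    using evenperm_odd_stab[where \<psi> = \<psi> and x = y and g = id, OF perm comp _ odd(1)] by blast
  have "(card H - card (orb y)) + (card H - card (orb z))
      = (\<Sum>p\<in>orb y \<union> orb z. card (stab p \<inter> ?K) - 1)"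
    using weight(1)[OF yz(1) odd(1)] weight(1)[OF yz(2) odd(2)] yz(3)
    by (subst sum.union_disjoint) (auto simp: finite_orb)
  also have "\<dots> \<le> (\<Sum>p\<in>poles. card (stab p \<inter> ?K) - 1)"
    using orb_subset_poles yz finite_poles by (intro sum_mono2) auto
  also have "\<dots> = 2 * (card ?K - 1)" using id id_mem by (intro pole_count) auto
  finally have bound: "(card H - card (orb y)) + (card H - card (orb z)) \<le> 2 * (card ?K - 1)" .
  have "card H > 0" using finite_H id_mem card_gt_0_iff by blast
  then show "card H < 2 * card ?K"
    using bound weight(2)[OF yz(1) odd(1)] weight(2)[OF yz(2) odd(2)] by linarith
qed

text \<open>
  The group acts faithfully on the four points of an orbit, as only the identity fixes more than two.
\<close>

lemma iso_alt_group_4: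
  assumes "card H = 12" "card (stab y) = 3" "card (stab z) = 3" "orb y \<inter> orb z = {}"
  shows "transformation_monoid H \<cong> alt_group 4"
proof -
  have four: "card (orb y) = 4" using orbit_stabilizer[of y] assms by simp
  obtain \<psi> :: "('a \<Rightarrow> 'a) \<Rightarrow> nat \<Rightarrow> nat" where \<psi>: "\<And>g. g \<in> H \<Longrightarrow> \<psi> g permutes {1..4}"
    "\<And>g h. g \<in> H \<Longrightarrow> h \<in> H \<Longrightarrow> \<psi> (g \<circ> h) = \<psi> g \<circ> \<psi> h" "inj_on \<psi> H"
  proof (rule faithful_action_embeds[OF finite_orb four, where act = "\<lambda>g. g"])
    show "g = id" if "g \<in> H" "\<And>p. p \<in> orb y \<Longrightarrow> g p = p" for g
      using that four by (intro eq_id_if_three_fixed[of g "orb y"]) auto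
  qed (auto intro: orb_closed)
  have "permutation (\<psi> g)" if "g \<in> H" for g
    using \<psi>(1)[OF that] permutation_permutes by blast
  then have "evenperm (\<psi> g)" if "g \<in> H" for g
    using evenperm_two_odd_orbits[of \<psi> y z] \<psi>(2) assms that by (simp add: poles_def)
  then show ?thesis
    using assms \<psi> by (intro iso_alt_group[of 4 \<psi>]) (simp_all add: fact_numeral)
qed

end

section \<open>The octahedral case\<close>

context two_point_group begin

text \<open>
  For a pole \<open>p\<close>, this is the pair of poles on the axis of \<open>p\<close>.
\<close>

definition same_stab :: "'a \<Rightarrow> 'a set" where
  "same_stab p = {q. stab q = stab p}"

lemma same_stab_image:
  assumes g: "g \<in> H"
  shows "g ` same_stab p = same_stab (g p)"
proof -
  have sub: "g ` same_stab p \<subseteq> same_stab (g p)" if g: "g \<in> H" for g p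
  proof -
    have "h \<in> stab (g q) \<longleftrightarrow> h \<in> H \<and> inv' g \<circ> h \<circ> g \<in> stab q" for h q
    proof -
      have "inv' g (h (g q)) = q \<longleftrightarrow> h (g q) = g q"
        using g inv_cancel by metis
      moreover have "h \<in> H \<Longrightarrow> inv' g \<circ> h \<circ> g \<in> H"
        using g comp_mem inv_mem by blast
      ultimately show ?thesis by (auto simp: stab_def)
    qed
    then have "stab (g q) = stab (g p)" if "stab q = stab p" for q
      using that by blast
    then show ?thesis unfolding same_stab_def by blast
  qed
  have "same_stab (g p) = g ` inv' g ` same_stab (g p)"
    using g by (simp add: image_comp)
  also have "\<dots> \<subseteq> g ` same_stab (inv' g (g p))"
    using sub[OF inv_mem[OF g]] by (rule image_mono)
  finally show ?thesis using sub[OF g] g by auto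
qed

text \<open>
  An element that preserves every axis of order 3 has a square that fixes all poles on these
  axes, so it is an involution or trivial; hence it is trivial as soon as it fixes one of these poles,
  by comparison with the order 3 of the stabilizer. If \<open>g\<close> is not trivial, it
  therefore interchanges \<open>y\<close> with the other pole \<open>y'\<close> on its axis. For a nontrivial \<open>h\<close> in the stabilizer of \<open>y\<close>, the
  element \<open>g h g h\<^sup>-\<^sup>1\<close> preserves all axes and fixes \<open>y\<close>, so it is trivial and \<open>g\<close> commutes with \<open>h\<close>; but \<open>g h\<close>
  interchanges \<open>y\<close> and \<open>y'\<close> and is an involution. Together, \<open>h\<close> is an involution, which its order
  forbids.
\<close>

lemma kernel_on_axes_trivial:
  assumes y: "card (stab y) = 3" "card (orb y) > 2"
    and g: "g \<in> H" "\<And>q. q \<in> orb y \<Longrightarrow> g ` same_stab q = same_stab q"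
  shows "g = id"
proof -
  define K where "K = {k \<in> H. \<forall>q\<in>orb y. k ` same_stab q = same_stab q}"
  have K_comp: "k \<circ> l \<in> K" if "k \<in> K" "l \<in> K" for k l
    using that unfolding K_def mem_Collect_eq image_comp[symmetric] by (simp add: comp_mem)
  have K_conj: "h \<circ> k \<circ> inv' h \<in> K" if "h \<in> H" "k \<in> K" for h k
  proof -
    have "(h \<circ> k \<circ> inv' h) ` same_stab q = same_stab q" if q: "q \<in> orb y" for q
    proof -
      have "inv' h q \<in> orb y" using orb_closed inv_mem \<open>h \<in> H\<close> q by blast
      then have "k ` same_stab (inv' h q) = same_stab (inv' h q)"
        using \<open>k \<in> K\<close> by (simp add: K_def)
      then show ?thesis
        unfolding image_comp[symmetric]
        using \<open>h \<in> H\<close> by (simp add: same_stab_image inv_mem)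
    qed
    then show ?thesis using that conj_mem by (simp add: K_def)
  qed
  have stab3: "card (stab q) = 3" if "q \<in> orb y" for q
    using that y card_stab_orb by metis
  have axis: "\<exists>q'. q' \<noteq> q \<and> same_stab q = {q, q'}" if q: "q \<in> orb y" for q
  proof -
    have "card (same_stab q) = 2" "q \<in> same_stab q"
      using card_same_stab[of q] stab3[OF q] by (simp_all add: same_stab_def)
    then show ?thesis by (auto simp: card_2_iff doubleton_eq_iff)
  qed
  have swaps: "k q = q \<and> k q' = q' \<or> k q = q' \<and> k q' = q"
    if "k \<in> K" "q \<in> orb y" "same_stab q = {q, q'}" for k q q'
    using that by (auto simp: K_def doubleton_eq_iff)
  have square: "k \<circ> k = id" if k: "k \<in> K" for k
  proof (rule eq_id_if_three_fixed)
    show "k \<circ> k \<in> H" using k comp_mem by (simp add: K_def)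
    show "orb y \<subseteq> {q. (k \<circ> k) q = q}" using axis swaps[OF k] by fastforce
  qed (fact y)
  have cube: "k = id" if "k \<in> stab q" "q \<in> orb y" "k \<circ> k = id" for k q
  proof -
    have "k \<circ> (k \<circ> k) = id"
      using stab_pow_card[OF that(1)] stab3[OF that(2)] by (simp add: eval_nat_numeral)
    then show ?thesis using that(3) by simp
  qed
  have K_fix: "k = id" if "k \<in> K" "k q = q" "q \<in> orb y" for k q
    using that square cube by (auto simp: K_def stab_def)
  show "g = id"
  proof (rule ccontr)
    assume "g \<noteq> id"
    have gK: "g \<in> K" using g by (simp add: K_def)
    obtain y' where y': "y' \<noteq> y" "same_stab y = {y, y'}" using axis[OF orb_self] by blast
    have gy: "g y = y'" "g y' = y"
      using swaps[OF gK orb_self y'(2)] K_fix[OF gK _ orb_self] \<open>g \<noteq> id\<close> by auto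
    have "\<not> stab y \<subseteq> {id}" using y(1) card_mono[of "{id}" "stab y"] by auto
    then obtain h where h: "h \<in> stab y" "h \<noteq> id" by blast
    have "h \<in> stab y'" using h y'(2) by (auto simp: same_stab_def)
    then have hy: "h y = y" "h y' = y'" "h \<in> H" using h by (auto simp: stab_def)
    have inv_hy: "inv' h y = y" using hy inv_cancel(1)[of h y] by simp
    have "g \<circ> (h \<circ> g \<circ> inv' h) = id"
    proof (rule K_fix[OF _ _ orb_self])
      show "g \<circ> (h \<circ> g \<circ> inv' h) \<in> K" using gK hy K_comp K_conj by blast
      show "(g \<circ> (h \<circ> g \<circ> inv' h)) y = y" using gy hy inv_hy by simp
    qed
    then have "g \<circ> (h \<circ> g \<circ> inv' h) \<circ> h = h" by simp
    then have 1: "g \<circ> h \<circ> g = h" using hy(3) by (simp add: comp_assoc)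
    have "(g \<circ> h) \<circ> (g \<circ> h) = id"
    proof (rule swap_involution)
      show "(g \<circ> h) y = y'" "(g \<circ> h) y' = y" using gy hy by simp_all
    qed (use g hy y' comp_mem in auto)
    then have "(g \<circ> h \<circ> g) \<circ> h = id" by (simp only: comp_assoc)
    then have "h \<circ> h = id" by (simp only: 1)
    then show False using cube[OF h(1) orb_self] h(2) by blast
  qed
qed

text \<open>
  All points with a stabilizer of order 3 lie in one orbit of 8 points, so both poles of an axis
  of order 3 belong to it and there are four axes. The action on them gives 24 permutations.
\<close>

lemma iso_sym_group_4:
  assumes N: "card H = 24" and y: "card (stab y) = 3"
    and all: "\<And>p. card (stab p) = 3 \<Longrightarrow> p \<in> orb y"
  shows "transformation_monoid H \<cong> sym_group 4"
proof -
  have eight: "card (orb y) = 8" using orbit_stabilizer[of y] N y by simp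
  define Y where "Y = same_stab ` orb y"
  have stab3: "card (stab q) = 3" if "q \<in> orb y" for q
    using that y card_stab_orb by metis
  have "(8::nat) = (\<Sum>B\<in>Y. \<Sum>q\<in>{q \<in> orb y. same_stab q = B}. 1)"
    using eight by (subst sum.group) (auto simp: finite_orb Y_def)
  also have "\<dots> = (\<Sum>B\<in>Y. 2)"
  proof (rule sum.cong[OF refl])
    fix B assume "B \<in> Y"
    then obtain p where p: "p \<in> orb y" "B = same_stab p" by (auto simp: Y_def)
    have "{q \<in> orb y. same_stab q = B} = same_stab p"
    proof
      show "{q \<in> orb y. same_stab q = B} \<subseteq> same_stab p"
        using p(2) by (auto simp: same_stab_def)
      show "same_stab p \<subseteq> {q \<in> orb y. same_stab q = B}"
        using p(2) all stab3[OF p(1)] by (auto simp: same_stab_def)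
    qed
    then show "(\<Sum>q\<in>{q \<in> orb y. same_stab q = B}. 1) = (2::nat)"
      using card_same_stab[of p] stab3[OF p(1)] by (simp add: same_stab_def)
  qed
  finally have four: "card Y = 4" by simp
  obtain \<psi> :: "('a \<Rightarrow> 'a) \<Rightarrow> nat \<Rightarrow> nat" where \<psi>: "\<And>g. g \<in> H \<Longrightarrow> \<psi> g permutes {1..4}"
    "\<And>g h. g \<in> H \<Longrightarrow> h \<in> H \<Longrightarrow> \<psi> (g \<circ> h) = \<psi> g \<circ> \<psi> h" "inj_on \<psi> H"
  proof (rule faithful_action_embeds[OF _ four, where act = image])
    show "finite Y" by (simp add: Y_def finite_orb)
    show "g ` B \<in> Y" if "g \<in> H" "B \<in> Y" for g B
      using that orb_closed by (auto simp: Y_def same_stab_image)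
    show "g = id" if "g \<in> H" "\<And>B. B \<in> Y \<Longrightarrow> g ` B = B" for g
      using that y eight by (intro kernel_on_axes_trivial[of y g]) (auto simp: Y_def)
  qed (auto simp: image_comp)
  show ?thesis
    using N \<psi> by (intro iso_sym_group[of \<psi> 4]) (simp_all add: fact_numeral)
qed

end

section \<open>The icosahedral case\<close>

text \<open>
  A set of odd size is not a union of two-element orbits.
\<close>

lemma involution_on_three_fixes:
  assumes "card A = 3" "\<And>a. a \<in> A \<Longrightarrow> f a \<in> A" "\<And>a. f (f a) = a"
  shows "\<exists>a\<in>A. f a = a"
proof (rule ccontr)
  assume moved: "\<not> ?thesis"
  obtain a where a: "a \<in> A" using assms(1) by fastforce
  have "f a \<in> A" "f a \<noteq> a" using moved assms(2) a by auto
  then have "card (A - {a, f a}) = 1" using assms(1) a by (subst card_Diff_subset) auto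
  then obtain c where c: "A - {a, f a} = {c}" by (auto simp: card_1_singleton_iff)
  then have "f c \<in> A" "f c \<noteq> c" "c \<noteq> a" "c \<noteq> f a" using moved assms(2) by auto
  moreover from this have "f c \<noteq> a" "f c \<noteq> f a" using assms(3) by metis+
  ultimately show False using c by auto
qed

context two_point_group begin

definition conjugate :: "('a \<Rightarrow> 'a) \<Rightarrow> ('a \<Rightarrow> 'a) \<Rightarrow> 'a \<Rightarrow> 'a" where
  "conjugate g s = g \<circ> s \<circ> inv' g"

lemma conjugate_comp_left:
  assumes "g \<in> H" "h \<in> H"
  shows "conjugate (g \<circ> h) s = conjugate g (conjugate h s)"
  using assms by (simp add: conjugate_def comp_assoc o_inv_distrib bij_mem)

lemma conjugate_comp:
  assumes "g \<in> H"
  shows "conjugate g s \<circ> conjugate g t = conjugate g (s \<circ> t)"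
  using assms by (auto simp: conjugate_def fun_eq_iff)

lemma conjugate_id: "conjugate id s = s"
  by (simp add: conjugate_def)

lemma conjugate_eq_iff:
  assumes "g \<in> H"
  shows "conjugate g s = conjugate g t \<longleftrightarrow> s = t"
proof -
  have "s = conjugate (inv' g) (conjugate g s)" for s
    using conjugate_comp_left[OF inv_mem[OF assms] assms, of s] assms
    by (simp add: conjugate_id)
  then show ?thesis by metis
qed

lemma conjugate_id_right: "g \<in> H \<Longrightarrow> conjugate g id = id"
  by (simp add: conjugate_def)

lemma conjugate_eq_self_iff: "g \<in> H \<Longrightarrow> conjugate g s = s \<longleftrightarrow> g \<circ> s = s \<circ> g"
  unfolding conjugate_def by (metis comp_assoc comp_id inv_comp)

definition involutions :: "('a \<Rightarrow> 'a) set" where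
  "involutions = {t \<in> H. t \<noteq> id \<and> t \<circ> t = id}"

definition commuting_involutions :: "('a \<Rightarrow> 'a) \<Rightarrow> ('a \<Rightarrow> 'a) set" where
  "commuting_involutions t = {s \<in> involutions. s \<circ> t = t \<circ> s}"

lemma conjugate_involution:
  assumes "g \<in> H" "t \<in> involutions"
  shows "conjugate g t \<in> involutions"
  using assms conj_mem[of g t] conjugate_comp[of g t t] conjugate_id_right[of g]
    conjugate_eq_iff[of g t id]
  by (auto simp: involutions_def conjugate_def)

lemma conjugate_commuting_involutions:
  assumes g: "g \<in> H"
  shows "conjugate g ` commuting_involutions t = commuting_involutions (conjugate g t)"
proof
  have sub: "conjugate g s \<in> commuting_involutions (conjugate g t)"
    if "g \<in> H" "s \<in> commuting_involutions t" for g s t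
    using that conjugate_involution by (auto simp: commuting_involutions_def conjugate_comp)
  then show "conjugate g ` commuting_involutions t \<subseteq> commuting_involutions (conjugate g t)"
    using g by blast
  show "commuting_involutions (conjugate g t) \<subseteq> conjugate g ` commuting_involutions t"
  proof
    fix s assume s: "s \<in> commuting_involutions (conjugate g t)"
    have cancel: "conjugate (inv' g) (conjugate g r) = r" "conjugate g (conjugate (inv' g) r) = r" for r
      using conjugate_comp_left[OF inv_mem[OF g] g, of r] conjugate_comp_left[OF g inv_mem[OF g], of r] g
      by (simp_all add: conjugate_id)
    have "conjugate (inv' g) s \<in> commuting_involutions t"
      using sub[OF inv_mem[OF g] s] by (simp add: cancel)
    then show "s \<in> conjugate g ` commuting_involutions t" by (metis cancel(2) image_eqI)
  qed
qed

end

text \<open>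
  The involutions are exactly the nontrivial elements of the stabilizers along a single orbit of
  points with stabilizers of order 2. This makes all involutions conjugate and determines the
  centralizer of each of them.
\<close>

locale half_turn_group = two_point_group +
  fixes x :: 'a
  assumes card_stab_x: "card (stab x) = 2"
    and half_turn_axis: "t \<in> involutions \<Longrightarrow> t p = p \<Longrightarrow> p \<in> orb x"
begin

lemma stab_half_turn:
  assumes "t \<in> involutions" "t p = p"
  shows "stab p = {id, t}"
proof -
  have "{id, t} \<subseteq> stab p" "id \<noteq> t"
    using assms id_mem by (auto simp: stab_def involutions_def)
  then show ?thesis
    using card_stab_orb[OF half_turn_axis[OF assms]] card_stab_x finite_stab
    by (intro card_subset_eq[symmetric]) auto
qed

lemma half_turn_unique:
  assumes "p \<in> orb x"
  shows "\<exists>!t. t \<in> involutions \<and> t p = p"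
proof -
  have two: "card (stab p) = 2" using card_stab_orb[OF assms] card_stab_x by simp
  then have "\<not> stab p \<subseteq> {id}" using card_mono[of "{id}" "stab p"] by auto
  then obtain t where t: "t \<in> stab p" "t \<noteq> id" by blast
  then have "t \<in> involutions"
    using stab_pow_card[OF t(1)] two by (simp add: involutions_def stab_def eval_nat_numeral)
  moreover have "s = t" if "s \<in> involutions" "s p = p" for s
  proof -
    have "stab p = {id, s}" using that by (rule stab_half_turn)
    then show ?thesis using t by auto
  qed
  moreover have "t p = p" using t(1) by (simp add: stab_def)
  ultimately show ?thesis by blast
qed

lemma half_turn_poles:
  assumes "t \<in> involutions"
  obtains p q where "p \<noteq> q" "{r. t r = r} = {p, q}" "p \<in> orb x" "q \<in> orb x"
proof -
  have "card {r. t r = r} = 2" using assms two_fixed by (simp add: involutions_def)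
  then obtain p q where "p \<noteq> q" "{r. t r = r} = {p, q}" by (auto simp: card_2_iff)
  moreover from this have "t p = p" "t q = q" by auto
  ultimately show ?thesis using that half_turn_axis[OF assms] by blast
qed

lemma card_involutions: "2 * card involutions = card (orb x)"
proof -
  have "(\<Sum>p\<in>orb x. card {t \<in> involutions. t p = p}) = (\<Sum>t\<in>involutions. 2)"
  proof (rule sum_multicount_gen)
    show "finite involutions" using finite_H by (simp add: involutions_def)
    show "\<forall>t\<in>involutions. card {p \<in> orb x. t p = p} = 2"
    proof
      fix t assume t: "t \<in> involutions"
      then have "{p \<in> orb x. t p = p} = {p. t p = p}" using half_turn_axis by blast
      then show "card {p \<in> orb x. t p = p} = 2" using t two_fixed by (simp add: involutions_def)
    qed
  qed (rule finite_orb)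
  moreover have "card {t \<in> involutions. t p = p} = 1" if "p \<in> orb x" for p
    using half_turn_unique[OF that] by (auto simp: card_1_singleton_iff)
  ultimately show ?thesis by simp
qed

lemma involutions_conjugate:
  assumes "s \<in> involutions" "t \<in> involutions"
  obtains g where "g \<in> H" "conjugate g s = t"
proof -
  obtain p where p: "s p = p" "p \<in> orb x" using half_turn_poles[OF assms(1)] by blast
  obtain q where q: "t q = q" "q \<in> orb x" using half_turn_poles[OF assms(2)] by blast
  have "q \<in> orb p" using p q orb_eq by blast
  then obtain g where g: "g \<in> H" "q = g p" by (auto simp: orb_def)
  have "conjugate g s q = q" using g p by (simp add: conjugate_def)
  then have "conjugate g s = t"
    using half_turn_unique[OF q(2)] conjugate_involution[OF g(1) assms(1)] assms(2) q(1) by blast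
  then show ?thesis using that g by blast
qed

text \<open>
  An element that commutes with \<open>t\<close> permutes the two poles of \<open>t\<close>. If it fixes them it is \<open>id\<close> or
  \<open>t\<close>, since their stabilizers have order 2; if it interchanges them it is an involution, and it
  differs from a fixed such element \<open>u\<close> by \<open>id\<close> or \<open>t\<close>. An element \<open>u\<close> exists because the poles
  of \<open>t\<close> lie in the same orbit. So the centralizer of \<open>t\<close> is a Klein four-group.
\<close>

lemma four_group:
  assumes t: "t \<in> involutions"
  obtains u where "u \<noteq> t" "commuting_involutions t = {t, u, t \<circ> u}"
    and "u \<circ> t = t \<circ> u" "u \<noteq> t \<circ> u" "t \<noteq> t \<circ> u"
    and "\<And>g. g \<in> H \<Longrightarrow> g \<circ> t = t \<circ> g \<Longrightarrow> g = id \<or> g \<in> commuting_involutions t"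
proof -
  obtain p q where pq: "p \<noteq> q" "{r. t r = r} = {p, q}" "p \<in> orb x" "q \<in> orb x"
    using half_turn_poles[OF t] .
  have tpq: "t p = p" "t q = q" using pq(2) by auto
  have tH: "t \<in> H" "t \<noteq> id" "t \<circ> t = id" using t by (auto simp: involutions_def)
  have "q \<in> orb p" using pq orb_eq by blast
  then obtain u where u: "u \<in> H" "u p = q" by (auto simp: orb_def)
  have "conjugate u t q = q"
    using u tpq inv_cancel(1)[OF u(1), of p] by (simp add: conjugate_def)
  then have "conjugate u t = t"
    using half_turn_unique[OF pq(4)] conjugate_involution[OF u(1) t] t tpq by blast
  then have comm: "u \<circ> t = t \<circ> u" using u conjugate_eq_self_iff by blast
  have swaps: "g p = p \<and> g q = q \<or> g p = q \<and> g q = p" if "g \<in> H" "g \<circ> t = t \<circ> g" for g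
  proof -
    have "t (g r) = g r" if "t r = r" for r
      using that \<open>g \<circ> t = t \<circ> g\<close> by (metis comp_apply)
    then have "g p \<in> {p, q}" "g q \<in> {p, q}" using pq(2) tpq by blast+
    moreover have "g p \<noteq> g q" using apply_eq_iff[OF \<open>g \<in> H\<close>] pq(1) by simp
    ultimately show ?thesis by auto
  qed
  have inv: "g \<in> involutions" if "g \<in> H" "g p = q" "g q = p" for g
    using swap_involution[of g p q] that pq(1) by (auto simp: involutions_def)
  have uq: "u q = p" using swaps[OF u(1) comm] u(2) pq(1) by auto
  have uI: "u \<in> involutions" using inv u uq by blast
  have tuI: "t \<circ> u \<in> involutions" using inv[of "t \<circ> u"] u uq tpq tH comp_mem by simp
  have uu: "u \<circ> u = id" using uI by (simp add: involutions_def)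
  have cases: "g \<in> {id, t, u, t \<circ> u}" if g: "g \<in> H" "g \<circ> t = t \<circ> g" for g
  proof (cases "g p = p")
    case True
    then have "g \<in> stab p" using g by (simp add: stab_def)
    then show ?thesis using stab_half_turn[OF t tpq(1)] by auto
  next
    case False
    then have "(u \<circ> g) p = p" using swaps[OF g] uq by auto
    then have "u \<circ> g \<in> stab p" using g u comp_mem by (simp add: stab_def)
    then have "u \<circ> g = id \<or> u \<circ> g = t" using stab_half_turn[OF t tpq(1)] by auto
    then have "u \<circ> (u \<circ> g) = u \<or> u \<circ> (u \<circ> g) = u \<circ> t" by auto
    then show ?thesis using uu comm by (simp add: comp_assoc[symmetric])
  qed
  have tu: "(t \<circ> u) \<circ> t = t \<circ> (t \<circ> u)" using comm by (simp add: comp_assoc)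
  have C: "commuting_involutions t = {t, u, t \<circ> u}"
  proof
    show "commuting_involutions t \<subseteq> {t, u, t \<circ> u}"
      using cases by (auto simp: commuting_involutions_def involutions_def)
    show "{t, u, t \<circ> u} \<subseteq> commuting_involutions t"
      using t uI tuI comm tu by (simp add: commuting_involutions_def)
  qed
  show ?thesis
  proof
    show "u \<noteq> t" using u tpq pq(1) by auto
    show "u \<noteq> t \<circ> u"
    proof
      assume "u = t \<circ> u"
      then have "u \<circ> u = t \<circ> (u \<circ> u)" by (metis comp_assoc)
      then show False using uu tH by simp
    qed
    show "t \<noteq> t \<circ> u"
    proof
      assume "t = t \<circ> u"
      then have "t \<circ> t = (t \<circ> t) \<circ> u" by (metis comp_assoc)
      then show False using tH uI by (simp add: involutions_def)
    qed
    show "g = id \<or> g \<in> commuting_involutions t" if "g \<in> H" "g \<circ> t = t \<circ> g" for g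
      using cases[OF that] C by auto
  qed (use C comm in auto)
qed

lemma card_commuting_involutions: "t \<in> involutions \<Longrightarrow> card (commuting_involutions t) = 3"
  by (erule four_group) auto

lemma commuting_involutions_self: "t \<in> involutions \<Longrightarrow> t \<in> commuting_involutions t"
  by (simp add: commuting_involutions_def)

lemma finite_involutions: "finite involutions"
  using finite_H by (simp add: involutions_def)

lemma commuting_involutions_comp:
  assumes t: "t \<in> involutions" and r: "r \<in> commuting_involutions t" and s: "s \<in> commuting_involutions t"
  shows "r \<circ> s = s \<circ> r" "r \<circ> s = id \<or> r \<circ> s \<in> commuting_involutions t"
proof -
  obtain u where u: "commuting_involutions t = {t, u, t \<circ> u}" "u \<circ> t = t \<circ> u"
    and cent: "\<And>g. g \<in> H \<Longrightarrow> g \<circ> t = t \<circ> g \<Longrightarrow> g = id \<or> g \<in> commuting_involutions t"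
    using four_group[OF t] by metis
  have *: "t (u z) = u (t z)" for z using u(2) by (metis comp_apply)
  show "r \<circ> s = s \<circ> r" using r s by (auto simp: u(1) * fun_eq_iff)
  have "r \<circ> s \<in> H" "r \<circ> t = t \<circ> r" "s \<circ> t = t \<circ> s"
    using r s comp_mem by (auto simp: commuting_involutions_def involutions_def)
  moreover from this have "r \<circ> s \<circ> t = t \<circ> (r \<circ> s)" by (metis comp_assoc)
  ultimately show "r \<circ> s = id \<or> r \<circ> s \<in> commuting_involutions t" using cent by blast
qed

text \<open>
  Commuting is an equivalence relation on the involutions. Its classes are the sets of nontrivial
  elements of the Klein four-groups.
\<close>

lemma commuting_involutions_eq:
  assumes t: "t \<in> involutions" and s: "s \<in> commuting_involutions t"
  shows "commuting_involutions s = commuting_involutions t"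
proof -
  have sI: "s \<in> involutions" using s by (simp add: commuting_involutions_def)
  have "commuting_involutions t \<subseteq> commuting_involutions s"
    using commuting_involutions_comp(1)[OF t _ s] by (auto simp: commuting_involutions_def)
  moreover have "finite (commuting_involutions s)"
    using finite_involutions by (simp add: commuting_involutions_def)
  ultimately show ?thesis
    using card_commuting_involutions t sI by (intro card_subset_eq[symmetric]) auto
qed

text \<open>
  An involution in the kernel \<open>K\<close> of the action on the Klein four-groups would bring all its
  conjugates, hence all involutions, into \<open>K\<close>. Acting on the three involutions of a four-group,
  an involution of \<open>K\<close> fixes one, commutes with it and so belongs to the four-group; but there
  are involutions outside. So \<open>K\<close> contains no involution. For an involution \<open>t\<close>, the commutator of
  \<open>g\<close> and \<open>t\<close> lies in \<open>K\<close> and in the four-group of \<open>t\<close>, hence is trivial. So \<open>g\<close>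
  centralizes \<open>t\<close>: it is the identity or an involution in \<open>K\<close>, and there are none.
\<close>

lemma kernel_on_four_groups_trivial:
  assumes many: "card involutions > 3"
    and g: "g \<in> H" "\<And>t. t \<in> involutions \<Longrightarrow> conjugate g ` commuting_involutions t = commuting_involutions t"
  shows "g = id"
proof -
  let ?C = commuting_involutions
  define K where "K = {k \<in> H. \<forall>t\<in>involutions. conjugate k ` ?C t = ?C t}"
  have image_comp_conj: "conjugate (k \<circ> l) ` A = conjugate k ` conjugate l ` A"
    if "k \<in> H" "l \<in> H" for k l A
    using conjugate_comp_left[OF that] by (simp add: image_image)
  have K_comp: "k \<circ> l \<in> K" if "k \<in> K" "l \<in> K" for k l
    using that by (simp add: K_def comp_mem image_comp_conj)
  have K_conj: "conjugate h k \<in> K" if "h \<in> H" "k \<in> K" for h k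
  proof -
    have "conjugate (h \<circ> k \<circ> inv' h) ` ?C t = ?C t" if t: "t \<in> involutions" for t
    proof -
      have "conjugate (inv' h) t \<in> involutions"
        using conjugate_involution inv_mem \<open>h \<in> H\<close> t by blast
      then have "conjugate k ` ?C (conjugate (inv' h) t) = ?C (conjugate (inv' h) t)"
        using \<open>k \<in> K\<close> by (simp add: K_def)
      moreover have "conjugate h (conjugate (inv' h) t) = t"
        using \<open>h \<in> H\<close> conjugate_comp_left[of h "inv' h" t] by (simp add: inv_mem conjugate_id)
      ultimately show ?thesis
        using that \<open>h \<in> H\<close> \<open>k \<in> K\<close> image_comp_conj[of "h \<circ> k" "inv' h"] image_comp_conj[of h k]
        by (simp add: K_def inv_mem comp_mem conjugate_commuting_involutions)
    qed
    then show ?thesis using that conj_mem[of h k] by (simp add: K_def conjugate_def)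
  qed
  have no_involution: "k \<notin> K" if k: "k \<in> involutions" for k
  proof
    assume kK: "k \<in> K"
    have "\<not> involutions \<subseteq> ?C k"
      using many card_mono[of "?C k" involutions] card_commuting_involutions[OF k]
        finite_involutions by (auto simp: commuting_involutions_def)
    then obtain s where s: "s \<in> involutions" "s \<notin> ?C k" by blast
    obtain h where "h \<in> H" "conjugate h k = s" using involutions_conjugate[OF k s(1)] .
    then have "s \<in> K" using K_conj kK by blast
    then have img: "conjugate s ` ?C k = ?C k" using k by (simp add: K_def)
    have sH: "s \<in> H" "s \<circ> s = id" using s by (auto simp: involutions_def)
    have twice: "conjugate s (conjugate s r) = r" for r
      using conjugate_comp_left[OF sH(1,1), of r] sH(2) by (simp add: conjugate_id)
    have "\<exists>r\<in>?C k. conjugate s r = r"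
      using card_commuting_involutions[OF k] img twice by (intro involution_on_three_fixes) auto
    then obtain r where r: "r \<in> ?C k" "conjugate s r = r" by blast
    then have "s \<circ> r = r \<circ> s" using conjugate_eq_self_iff sH by blast
    then have "s \<in> ?C r" using s by (simp add: commuting_involutions_def)
    then show False using commuting_involutions_eq[OF k r(1)] s(2) by simp
  qed
  have gK: "g \<in> K" using g by (simp add: K_def)
  have commutes: "g \<circ> t = t \<circ> g" if t: "t \<in> involutions" for t
  proof -
    have tH: "t \<in> H" "t \<circ> t = id" using t by (auto simp: involutions_def)
    have inv_t: "inv' t = t"
    proof
      show "inv' t z = t z" for z using inv_cancel(1)[OF tH(1), of "t z"] tH(2) by (metis comp_apply id_apply)
    qed
    have "conjugate g t \<in> ?C t" using g(2)[OF t] commuting_involutions_self[OF t] by blast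
    then have 1: "conjugate g t \<circ> t = id \<or> conjugate g t \<circ> t \<in> ?C t"
      using commuting_involutions_comp(2)[OF t] commuting_involutions_self[OF t] by blast
    have "conjugate (inv' g) ` ?C r = ?C r" if "r \<in> involutions" for r
    proof -
      have "conjugate (inv' g) ` ?C r = conjugate (inv' g) ` conjugate g ` ?C r"
        using g(2)[OF that] by simp
      also have "\<dots> = ?C r"
        using g(1) by (simp add: image_comp_conj[symmetric] inv_mem conjugate_id)
      finally show ?thesis .
    qed
    then have "inv' g \<in> K" using inv_mem[OF g(1)] by (simp add: K_def)
    then have "g \<circ> conjugate t (inv' g) \<in> K" using gK K_comp K_conj tH by blast
    moreover have "g \<circ> conjugate t (inv' g) = conjugate g t \<circ> t"
      by (simp add: conjugate_def inv_t comp_assoc)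
    ultimately have "conjugate g t \<circ> t = id"
      using 1 no_involution by (auto simp: commuting_involutions_def)
    then have "conjugate g t \<circ> (t \<circ> t) = t" by (simp add: comp_assoc[symmetric])
    then show ?thesis using conjugate_eq_self_iff g(1) tH by simp
  qed
  have "involutions \<noteq> {}" using many by auto
  then obtain t where t: "t \<in> involutions" by blast
  then have "g = id \<or> g \<in> ?C t" using four_group[OF t] commutes[OF t] g(1) by metis
  then show ?thesis using no_involution gK by (auto simp: commuting_involutions_def)
qed

lemma faithful_on_four_groups:
  assumes many: "card involutions > 3" and n: "card involutions = 3 * n"
  obtains \<psi> :: "('a \<Rightarrow> 'a) \<Rightarrow> nat \<Rightarrow> nat" where "\<And>g. g \<in> H \<Longrightarrow> \<psi> g permutes {1..n}"
    "\<And>g h. g \<in> H \<Longrightarrow> h \<in> H \<Longrightarrow> \<psi> (g \<circ> h) = \<psi> g \<circ> \<psi> h" "inj_on \<psi> H"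
proof -
  let ?C = commuting_involutions
  define Y where "Y = ?C ` involutions"
  have "3 * n = (\<Sum>B\<in>Y. \<Sum>s\<in>{s \<in> involutions. ?C s = B}. 1)"
    using n by (subst sum.group) (auto simp: finite_involutions Y_def)
  also have "\<dots> = (\<Sum>B\<in>Y. 3)"
  proof (rule sum.cong[OF refl])
    fix B assume "B \<in> Y"
    then obtain t where t: "t \<in> involutions" "B = ?C t" by (auto simp: Y_def)
    have "{s \<in> involutions. ?C s = B} = ?C t"
      using t commuting_involutions_eq[OF t(1)] commuting_involutions_self
      by (auto simp: commuting_involutions_def[of t])
    then show "(\<Sum>s\<in>{s \<in> involutions. ?C s = B}. 1) = (3::nat)"
      using card_commuting_involutions[OF t(1)] by simp
  qed
  finally have cardY: "card Y = n" by simp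
  show ?thesis
  proof (rule faithful_action_embeds[OF _ cardY, where act = "\<lambda>g. image (conjugate g)"])
    show "finite Y" by (simp add: Y_def finite_involutions)
    show "conjugate g ` B \<in> Y" if "g \<in> H" "B \<in> Y" for g B
      using that conjugate_involution by (auto simp: Y_def conjugate_commuting_involutions)
    show "conjugate (g \<circ> h) ` B = conjugate g ` conjugate h ` B" if "g \<in> H" "h \<in> H" for g h B
      using conjugate_comp_left[OF that] by (simp add: image_image)
    show "g = id" if "g \<in> H" "\<And>B. B \<in> Y \<Longrightarrow> conjugate g ` B = B" for g
      using that many by (intro kernel_on_four_groups_trivial) (auto simp: Y_def)
    show "conjugate id ` B = B" for B by (simp add: conjugate_id)
  qed (rule that)
qed

end

section \<open>The classification\<close>

context two_point_group begin

text \<open>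
  An involution can only fix points with a stabilizer of even order, so its poles lie in the orbit
  of \<open>x\<close>. That orbit has 30 points, so there are 15 involutions and five Klein four-groups.
\<close>

lemma iso_alt_group_5:
  assumes N: "card H = 60" and x: "card (stab x) = 2" and y: "card (stab y) = 3"
    and z: "card (stab z) = 5" and poles: "poles = orb x \<union> orb y \<union> orb z" 
    and disj: "orb y \<inter> orb z = {}"
  shows "transformation_monoid H \<cong> alt_group 5"
proof -
  interpret half_turn_group H x
  proof
    fix t p assume t: "t \<in> involutions" "t p = p"
    then have tp: "t \<in> stab p" "t \<noteq> id" "t \<circ> t = id"
      by (auto simp: involutions_def stab_def)
    have "p \<in> poles" using t by (auto simp: poles_iff involutions_def)
    moreover have "p \<notin> orb y"
    proof
      assume "p \<in> orb y"
      then have "t \<circ> (t \<circ> t) = id"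
        using stab_pow_card[OF tp(1)] card_stab_orb y by (simp add: eval_nat_numeral)
      then show False using tp by simp
    qed
    moreover have "p \<notin> orb z"
    proof
      assume "p \<in> orb z"
      then have "t \<circ> (t \<circ> (t \<circ> (t \<circ> t))) = id"
        using stab_pow_card[OF tp(1)] card_stab_orb z by (simp add: eval_nat_numeral)
      then show False using tp by simp
    qed
    ultimately show "p \<in> orb x" using poles by blast
  qed (fact x)
  have "card involutions = 3 * 5"
    using card_involutions orbit_stabilizer[of x] N x by simp
  moreover from this have "card involutions > 3" by simp
  ultimately obtain \<psi> :: "('a \<Rightarrow> 'a) \<Rightarrow> nat \<Rightarrow> nat" where \<psi>: "\<And>g. g \<in> H \<Longrightarrow> \<psi> g permutes {1..5}"
    "\<And>g h. g \<in> H \<Longrightarrow> h \<in> H \<Longrightarrow> \<psi> (g \<circ> h) = \<psi> g \<circ> \<psi> h" "inj_on \<psi> H"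
    using faithful_on_four_groups[of 5] by blast
  have "permutation (\<psi> g)" if "g \<in> H" for g
    using \<psi>(1)[OF that] permutation_permutes by blast
  then have "evenperm (\<psi> g)" if "g \<in> H" for g
    using evenperm_two_odd_orbits[of \<psi> y z] \<psi>(2) y z disj that by (simp add: poles_def)
  then show ?thesis
    using N \<psi> by (intro iso_alt_group[of 5 \<psi>]) (simp_all add: fact_numeral)
qed

text \<open>
  In the first case the group is a point stabilizer and hence cyclic.
\<close>

theorem classification:
  assumes "card H \<ge> 2"
  shows "(\<exists>x. stab x = H) \<or> transformation_monoid H \<cong> alt_group 5 \<or>
    transformation_monoid H \<cong> sym_group 4 \<or> transformation_monoid H \<cong> alt_group 4 \<or>
    (\<exists>m\<ge>2. transformation_monoid H \<cong> dihedral_group m)"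
proof (rule pole_orbits[OF assms])
  fix x y z
  assume 2: "poles = orb x \<union> orb y \<union> orb z"
    "orb x \<inter> orb y = {}" "orb x \<inter> orb z = {}" "orb y \<inter> orb z = {}"
    "2 \<le> card (stab x)" "card (stab x) \<le> card (stab y)" "card (stab y) \<le> card (stab z)"
    "card (orb x) + card (orb y) + card (orb z) = card H + 2"
  have "card H > 0" using assms by simp
  from orbit_sizes[OF orbit_stabilizer[of x] orbit_stabilizer[of y] orbit_stabilizer[of z] 2(5-8) this]
  consider (dihedral) "card (orb z) = 2"
    | (tetrahedral) "card (stab y) = 3" "card (stab z) = 3" "card H = 12"
    | (octahedral) "card (stab x) = 2" "card (stab y) = 3" "card (stab z) = 4" "card H = 24"
    | (icosahedral) "card (stab x) = 2" "card (stab y) = 3" "card (stab z) = 5" "card H = 60"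
    by (elim disjE conjE)
  then show ?thesis
  proof cases
    case dihedral
    moreover have "card (stab z) \<ge> 2" using 2(5-7) by simp
    ultimately show ?thesis using iso_dihedral_group[of z] by blast
  next
    case tetrahedral
    then show ?thesis using iso_alt_group_4[of y z] 2(4) by simp
  next
    case octahedral
    have "p \<in> orb y" if "card (stab p) = 3" for p
    proof -
      have "p \<in> poles" using that by (simp add: poles_def)
      then have "p \<in> orb x \<or> p \<in> orb y \<or> p \<in> orb z" unfolding 2(1) by blast
      then show ?thesis
        using card_stab_orb[of p x] card_stab_orb[of p z] that octahedral(1,3) by auto
    qed
    then show ?thesis using iso_sym_group_4[of y] octahedral by simp
  next
    case icosahedral
    then show ?thesis using iso_alt_group_5[of x y z] 2(1,4) by simp
  qed
qed blast

end

section \<open>Finite groups of Moebius transformations\<close>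

text \<open>
  Multiplication by \<open>a \<in> M\<close> permutes \<open>M\<close>; comparing the product of all elements before and after
  shows \<open>a ^ card M = 1\<close>. There are only \<open>card M\<close> such numbers.
\<close>

lemma finite_mult_closed_eq_roots_unity:
  fixes M :: "complex set"
  assumes M: "finite M" "M \<noteq> {}" "0 \<notin> M" and mult: "\<And>a b. a \<in> M \<Longrightarrow> b \<in> M \<Longrightarrow> a * b \<in> M"
  shows "M = {z. z ^ card M = 1}"
proof (rule card_subset_eq)
  have pos: "card M > 0" using M by (simp add: card_gt_0_iff)
  show "finite {z::complex. z ^ card M = 1}" using pos by (intro finite_roots_unity) simp
  show "card M = card {z::complex. z ^ card M = 1}" using pos by (simp add: card_roots_unity_eq)
  show "M \<subseteq> {z. z ^ card M = 1}"
  proof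
    fix a assume a: "a \<in> M"
    have inj: "inj_on ((*) a) M" using a M(3) by (auto simp: inj_on_def)
    then have "(*) a ` M = M" using M(1) mult a by (intro endo_inj_surj) auto
    then have "prod id M = prod id ((*) a ` M)" by simp
    also have "\<dots> = a ^ card M * prod id M"
      using inj by (simp add: prod.reindex prod.distrib)
    finally show "a \<in> {z. z ^ card M = 1}" using M by (auto simp: prod_zero_iff)
  qed
qed

lemma root_unity_power:
  assumes "m > 0" "z ^ m = 1"
  obtains k where "k < m" "z = cis (2 * pi / real m) ^ k"
proof -
  have "z \<in> (\<lambda>k. cis (2 * pi * real k / real m)) ` {..<m}"
    using bij_betw_roots_unity[OF assms(1)] assms(2) by (auto simp: bij_betw_def)
  then obtain k where "k < m" "z = cis (2 * pi * real k / real m)" by auto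
  then show ?thesis using that by (simp add: DeMoivre mult.commute)
qed

lemma cis_power_eq_1_iff:
  assumes "m > 0"
  shows "cis (2 * pi / real m) ^ k = 1 \<longleftrightarrow> m dvd k"
proof -
  have one: "cis (2 * pi / real m) ^ m = 1" using assms by (simp add: DeMoivre)
  have "cis (2 * pi / real m) ^ k = (cis (2 * pi / real m) ^ m) ^ (k div m) * cis (2 * pi / real m) ^ (k mod m)"
    by (simp add: power_mult[symmetric] power_add[symmetric])
  also have "\<dots> = cis (2 * pi * real (k mod m) / real m)"
    by (simp only: one) (simp add: DeMoivre mult.commute)
  finally have "cis (2 * pi / real m) ^ k = 1 \<longleftrightarrow>
      cis (2 * pi * real (k mod m) / real m) = cis (2 * pi * real 0 / real m)" by simp
  also have "\<dots> \<longleftrightarrow> k mod m = 0"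
    using bij_betw_roots_unity[OF assms] assms
    by (subst inj_on_eq_iff[of "\<lambda>k. cis (2 * pi * real k / real m)" "{..<m}"]) (auto simp: bij_betw_def)
  finally show ?thesis by (simp add: dvd_eq_mod_eq_0)
qed

lemma moebius_comp_mem:
  "f \<in> carrier moebius_group \<Longrightarrow> g \<in> carrier moebius_group \<Longrightarrow> f \<circ> g \<in> carrier moebius_group"
  using monoid.m_closed[OF group.is_monoid[OF group_moebius_group], of f g]
  by (simp add: moebius_group_def)

lemma moebius_id_mem: "id \<in> carrier moebius_group"
  using monoid.one_closed[OF group.is_monoid[OF group_moebius_group]] by (simp add: moebius_group_def)

lemma moebius_bij_inv:
  assumes "f \<in> carrier moebius_group"
  shows "bij f" "inv' f \<in> carrier moebius_group"
proof -
  interpret group moebius_group by (rule group_moebius_group)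
  let ?g = "inv\<^bsub>moebius_group\<^esub> f"
  have g: "?g \<circ> f = id" "f \<circ> ?g = id"
    using l_inv[OF assms] r_inv[OF assms] by (simp_all add: moebius_group_def)
  then show "bij f" by (rule o_bij)
  have "inv' f = ?g" using g by (intro inv_unique_comp)
  then show "inv' f \<in> carrier moebius_group" using assms by simp
qed

definition affine_map :: "complex \<Rightarrow> complex \<Rightarrow> riemann_sphere \<Rightarrow> riemann_sphere" where
  "affine_map a b = map_option (\<lambda>z. a * z + b)"

lemma affine_map_simps [simp]:
  "affine_map a b None = None" "affine_map a b (Some z) = Some (a * z + b)"
  by (simp_all add: affine_map_def)

lemma affine_map_mem: "a \<noteq> 0 \<Longrightarrow> affine_map a b \<in> carrier moebius_group"
proof -
  have "affine_map a b = moebius a b 0 1"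
    by (rule ext, case_tac x) simp_all
  then show "a \<noteq> 0 \<Longrightarrow> affine_map a b \<in> carrier moebius_group"
    by (simp add: moebius_in_moebius_group)
qed

lemma affine_map_comp: "affine_map a b \<circ> affine_map a' b' = affine_map (a * a') (a * b' + b)"
  by (rule ext, case_tac x) (simp_all add: algebra_simps)

lemma affine_map_eq_iff: "affine_map a b = affine_map a' b' \<longleftrightarrow> a = a' \<and> b = b'"
proof
  assume eq: "affine_map a b = affine_map a' b'"
  have "affine_map a b (Some 0) = affine_map a' b' (Some 0)" by (simp only: eq)
  moreover have "affine_map a b (Some 1) = affine_map a' b' (Some 1)" by (simp only: eq)
  ultimately show "a = a' \<and> b = b'" by simp
qed simp

lemma affine_map_id: "affine_map 1 0 = id"
  by (rule ext, case_tac x) simp_all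

lemma fixes_infinity_affine:
  assumes "f \<in> carrier moebius_group" "f None = None"
  obtains a b where "a \<noteq> 0" "f = affine_map a b"
proof -
  obtain a b c d where f: "f = moebius a b c d" "a * d - b * c \<noteq> 0"
    using assms(1) by (auto simp: moebius_group_def)
  have c: "c = 0" using assms(2) f(1) by (auto split: if_splits)
  then have "a \<noteq> 0" "d \<noteq> 0" using f(2) by auto
  moreover have "f = affine_map (a / d) (b / d)"
    unfolding f(1) by (rule ext, case_tac x) (use c \<open>d \<noteq> 0\<close> in \<open>simp_all add: add_divide_distrib\<close>)
  ultimately show ?thesis using that[of "a / d" "b / d"] by simp
qed

lemma moebius_to_infinity: "\<exists>T\<in>carrier moebius_group. T p = None"
proof (cases p)
  case None
  then show ?thesis using moebius_id_mem by (intro bexI[of _ id]) simp_all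
next
  case (Some z)
  have "moebius 0 1 1 (- z) p = None" by (simp add: Some)
  then show ?thesis using moebius_in_moebius_group[of 0 "- z" 1 1] by auto
qed

lemma conjugate_affine:
  assumes f: "f \<in> carrier moebius_group" "f p = p"
    and T: "T \<in> carrier moebius_group" "T p = None"
  obtains a b where "a \<noteq> 0" "T \<circ> f \<circ> inv' T = affine_map a b"
proof (rule fixes_infinity_affine)
  show "T \<circ> f \<circ> inv' T \<in> carrier moebius_group"
    by (intro moebius_comp_mem moebius_bij_inv(2) f(1) T(1))
  have "inv' T None = p"
    using T moebius_bij_inv(1)[OF T(1)] by (metis bij_inv_eq_iff)
  then show "(T \<circ> f \<circ> inv' T) None = None" using f T by simp
qed (use that in blast)

text \<open>
  With \<open>p\<close> moved to \<open>\<infinity>\<close>, an affine map with two finite fixed points remains.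
\<close>

lemma moebius_eq_id:
  assumes f: "f \<in> carrier moebius_group" and fixed: "f p = p" "f q = q" "f r = r"
    and dist: "p \<noteq> q" "p \<noteq> r" "q \<noteq> r"
  shows "f = id"
proof -
  obtain T where T: "T \<in> carrier moebius_group" "T p = None" using moebius_to_infinity by blast
  have bij: "bij T" using moebius_bij_inv T by blast
  have T_inj: "T x = T y \<longleftrightarrow> x = y" for x y using bij by (simp add: bij_is_inj inj_eq)
  have cancel: "inv' T (T x) = x" for x using bij by (simp add: bij_is_inj)
  obtain a b where ab: "T \<circ> f \<circ> inv' T = affine_map a b"
    using conjugate_affine[OF f fixed(1) T] by blast
  obtain z w where zw: "T q = Some z" "T r = Some w"
    using T_inj dist T(2) by (metis not_None_eq)
  have "affine_map a b (T x) = T (f x)" for x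
    using cancel by (simp add: ab[symmetric])
  then have "affine_map a b (Some z) = Some z" "affine_map a b (Some w) = Some w"
    using zw fixed by metis+
  then have e: "a * z + b = z" "a * w + b = w" by simp_all
  have "z \<noteq> w" using zw T_inj dist(3) by metis
  have "(a - 1) * (z - w) = (a * z + b - z) - (a * w + b - w)" by (simp add: algebra_simps)
  then have "(a - 1) * (z - w) = 0" using e by simp
  then have "a = 1" using \<open>z \<noteq> w\<close> by simp
  then have "affine_map a b = id" using e affine_map_id by simp
  then have "T \<circ> f \<circ> inv' T = id" using ab by simp
  then have "T (f x) = T x" for x using cancel by (metis comp_apply id_apply)
  then show ?thesis using T_inj by auto
qed

text \<open>
  If \<open>\<infinity>\<close> is not fixed, the finite fixed points are the roots of a polynomial of degree 2.
\<close>

lemma moebius_fixed_point: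
  assumes "f \<in> carrier moebius_group"
  shows "\<exists>p. f p = p"
proof -
  obtain a b c d where f: "f = moebius a b c d" "a * d - b * c \<noteq> 0"
    using assms by (auto simp: moebius_group_def)
  show ?thesis
  proof (cases "c = 0")
    case True
    then have "f None = None" by (simp add: f(1))
    then show ?thesis by blast
  next
    case False
    define s where "s = csqrt ((d - a)\<^sup>2 + 4 * b * c)"
    define z where "z = (a - d + s) / (2 * c)"
    have s2: "s\<^sup>2 = (d - a)\<^sup>2 + 4 * b * c" by (simp add: s_def)
    have cz: "2 * c * z = a - d + s" using False by (simp add: z_def)
    have "4 * c * (c * z\<^sup>2 + (d - a) * z - b) = (2 * c * z)\<^sup>2 + 2 * (d - a) * (2 * c * z) - 4 * b * c"
      by (simp add: power2_eq_square algebra_simps)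
    also have "\<dots> = s\<^sup>2 - (d - a)\<^sup>2 - 4 * b * c"
      unfolding cz by (simp add: power2_eq_square algebra_simps)
    also have "\<dots> = 0" by (simp add: s2)
    finally have "c * z\<^sup>2 + (d - a) * z - b = 0" using False by simp
    then have q: "a * z + b = z * (c * z + d)" by (simp add: power2_eq_square algebra_simps)
    have "c * z + d \<noteq> 0"
    proof
      assume 0: "c * z + d = 0"
      then have "a * z + b = 0" using q by simp
      then have "a * (c * z + d) - c * (a * z + b) = 0" using 0 by simp
      then show False using f(2) by (simp add: algebra_simps)
    qed
    then have "f (Some z) = Some z" using q by (simp add: f(1))
    then show ?thesis by blast
  qed
qed

locale finite_moebius_group = finite_transformation_group H
  for H :: "(riemann_sphere \<Rightarrow> riemann_sphere) set" +
  assumes H_moebius: "H \<subseteq> carrier moebius_group"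
begin

text \<open>
  The powers of a nontrivial translation are distinct, but \<open>H\<close> is finite.
\<close>

lemma no_translation:
  assumes f: "f \<in> H" and T: "bij T" and conj: "T \<circ> f \<circ> inv' T = affine_map 1 b"
  shows "f = id"
proof -
  have cancel: "inv' T (T x) = x" "T (inv' T x) = x" for x
    using T by (simp_all add: bij_is_inj bij_is_surj surj_f_inv_f)
  have step: "T (f x) = affine_map 1 b (T x)" for x
    using cancel by (simp add: conj[symmetric])
  have "T ((f ^^ k) (inv' T (Some 0))) = Some (of_nat k * b)" for k
    by (induction k) (simp_all add: cancel step algebra_simps)
  then have val: "f ^^ i = f ^^ j \<Longrightarrow> of_nat i * b = of_nat j * b" for i j
    by (metis option.inject)
  have "finite (range (\<lambda>k. f ^^ k))"
    using pow_mem[OF f] finite_H by (meson finite_subset image_subsetI)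
  then have "\<not> inj (\<lambda>k. f ^^ k)" using finite_imageD infinite_UNIV_nat by blast
  then obtain i j where "i \<noteq> j" "f ^^ i = f ^^ j" by (auto simp: inj_on_def)
  then have "b = 0" using val by fastforce
  then have "T (f x) = T x" for x using step affine_map_id by simp
  then show ?thesis using T by (metis bij_is_inj eq_id_iff inj_eq)
qed

text \<open>
  With \<open>p\<close> moved to \<open>\<infinity>\<close>, the stabilizer consists of affine maps \<open>z \<mapsto> a z + b\<close>, and \<open>a\<close> is the
  derivative. The kernel of this homomorphism consists of translations.
\<close>

lemma multiplier:
  "\<exists>\<mu> :: (riemann_sphere \<Rightarrow> riemann_sphere) \<Rightarrow> complex. inj_on \<mu> (stab p) \<and>
    (\<forall>f\<in>stab p. \<mu> f \<noteq> 0) \<and> \<mu> id = 1 \<and>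
    (\<forall>f\<in>stab p. \<forall>g\<in>stab p. \<mu> (f \<circ> g) = \<mu> f * \<mu> g)"
proof -
  obtain T where T: "T \<in> carrier moebius_group" "T p = None" using moebius_to_infinity by blast
  have bij: "bij T" using moebius_bij_inv T by blast
  have cancel: "inv' T \<circ> T = id" "T \<circ> inv' T = id"
    using bij by (auto simp: fun_eq_iff bij_is_inj bij_is_surj surj_f_inv_f)
  define \<mu> where "\<mu> f = (THE a. \<exists>b. T \<circ> f \<circ> inv' T = affine_map a b)" for f
  have \<mu>_eq: "\<mu> f = a" if "T \<circ> f \<circ> inv' T = affine_map a b" for f a b
    unfolding \<mu>_def using that by (intro the_equality) (auto simp: affine_map_eq_iff)
  have affine: "\<exists>a b. a \<noteq> 0 \<and> T \<circ> f \<circ> inv' T = affine_map a b" if "f \<in> stab p" for f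
  proof -
    have f: "f \<in> carrier moebius_group" "f p = p" using that H_moebius by (auto simp: stab_def)
    show ?thesis by (rule conjugate_affine[OF f T]) blast
  qed
  have one: "\<mu> id = 1" using \<mu>_eq[of id 1 0] cancel(2) affine_map_id by simp
  have mult: "\<mu> (f \<circ> g) = \<mu> f * \<mu> g" if fg: "f \<in> stab p" "g \<in> stab p" for f g
  proof -
    obtain a b where f: "T \<circ> f \<circ> inv' T = affine_map a b" using affine[OF fg(1)] by blast
    obtain a' b' where g: "T \<circ> g \<circ> inv' T = affine_map a' b'" using affine[OF fg(2)] by blast
    have "T \<circ> (f \<circ> g) \<circ> inv' T = T \<circ> f \<circ> (inv' T \<circ> T) \<circ> g \<circ> inv' T"
      by (simp add: cancel comp_assoc)
    also have "\<dots> = (T \<circ> f \<circ> inv' T) \<circ> (T \<circ> g \<circ> inv' T)" by (simp only: comp_assoc)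
    also have "\<dots> = affine_map (a * a') (a * b' + b)" by (simp only: f g affine_map_comp)
    finally show ?thesis using \<mu>_eq f g by metis
  qed
  have kernel: "f = id" if "f \<in> stab p" "\<mu> f = 1" for f
    using affine[OF that(1)] \<mu>_eq that no_translation[OF _ bij] by (auto simp: stab_def)
  have "inj_on \<mu> (stab p)"
  proof (rule inj_onI)
    fix f g assume fg: "f \<in> stab p" "g \<in> stab p" "\<mu> f = \<mu> g"
    have gH: "g \<in> H" using fg by (simp add: stab_def)
    have "inv' g p = p" using fg(2) inv_cancel(1)[OF gH, of p] by (simp add: stab_def)
    then have g': "inv' g \<in> stab p" using inv_mem[OF gH] by (simp add: stab_def)
    have "\<mu> (inv' g \<circ> f) = \<mu> (inv' g \<circ> g)" using mult g' fg by metis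
    then have "\<mu> (inv' g \<circ> f) = 1" using one gH by simp
    moreover have "inv' g \<circ> f \<in> stab p" using g' fg(1) comp_mem by (simp add: stab_def)
    ultimately have "inv' g \<circ> f = id" using kernel by blast
    then have "g \<circ> (inv' g \<circ> f) = g" by simp
    then show "f = g" using gH by (simp add: comp_assoc[symmetric])
  qed
  moreover have "\<mu> f \<noteq> 0" if "f \<in> stab p" for f using affine[OF that] \<mu>_eq by metis
  ultimately show ?thesis using one mult by blast
qed

lemma cyclic_point_stab: "\<exists>r. r ^^ card (stab p) = id \<and> stab p = range (\<lambda>k. r ^^ k)"
proof -
  obtain \<mu> :: "(riemann_sphere \<Rightarrow> riemann_sphere) \<Rightarrow> complex" where \<mu>: "inj_on \<mu> (stab p)"
    "\<And>f. f \<in> stab p \<Longrightarrow> \<mu> f \<noteq> 0" "\<mu> id = 1"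
    "\<And>f g. f \<in> stab p \<Longrightarrow> g \<in> stab p \<Longrightarrow> \<mu> (f \<circ> g) = \<mu> f * \<mu> g"
    using multiplier[of p] by blast
  define m where "m = card (stab p)"
  have m: "m > 0" using card_stab_pos by (simp add: m_def)
  have comp: "f \<circ> g \<in> stab p" if "f \<in> stab p" "g \<in> stab p" for f g
    using that comp_mem by (simp add: stab_def)
  have id: "id \<in> stab p" using id_mem by (simp add: stab_def)
  have roots: "\<mu> ` stab p = {z. z ^ m = 1}"
  proof -
    have "card (\<mu> ` stab p) = m" using \<mu>(1) by (simp add: card_image m_def)
    moreover have "\<mu> ` stab p = {z. z ^ card (\<mu> ` stab p) = 1}"
    proof (rule finite_mult_closed_eq_roots_unity)
      show "\<mu> ` stab p \<noteq> {}" using id by blast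
      show "a * b \<in> \<mu> ` stab p" if "a \<in> \<mu> ` stab p" "b \<in> \<mu> ` stab p" for a b
        using that \<mu>(4) comp by (metis (no_types, lifting) imageE imageI)
    qed (use finite_stab \<mu>(2) in auto)
    ultimately show ?thesis by simp
  qed
  have "cis (2 * pi / real m) \<in> \<mu> ` stab p" using roots m by (simp add: DeMoivre)
  then obtain r where r: "r \<in> stab p" "\<mu> r = cis (2 * pi / real m)" by auto
  have pow: "r ^^ k \<in> stab p \<and> \<mu> (r ^^ k) = \<mu> r ^ k" for k
  proof (induction k)
    case (Suc k)
    then have "r \<circ> r ^^ k \<in> stab p" "\<mu> (r \<circ> r ^^ k) = \<mu> r * \<mu> r ^ k"
      using comp[OF r(1), of "r ^^ k"] \<mu>(4)[OF r(1), of "r ^^ k"] by metis+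
    then show ?case by (simp only: funpow.simps(2) power_Suc simp_thms)
  qed (use id \<mu>(3) in \<open>simp only: funpow.simps(1) power_0 simp_thms\<close>)
  have "\<mu> (r ^^ m) = \<mu> id" using pow[of m] r m \<mu>(3) by (simp add: DeMoivre)
  then have "r ^^ m = id" using pow id \<mu>(1) by (meson inj_onD)
  moreover have "stab p \<subseteq> range (\<lambda>k. r ^^ k)"
  proof
    fix f assume f: "f \<in> stab p"
    then have "\<mu> f ^ m = 1" using roots by blast
    then obtain k where "\<mu> f = cis (2 * pi / real m) ^ k" using root_unity_power[OF m] by blast
    then have "\<mu> f = \<mu> (r ^^ k)" using pow r(2) by simp
    then have "f = r ^^ k" using f pow \<mu>(1) by (meson inj_onD)
    then show "f \<in> range (\<lambda>k. r ^^ k)" by blast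
  qed
  ultimately show ?thesis using pow unfolding m_def by blast
qed

lemma card_fixed_points:
  assumes f: "f \<in> H" "f \<noteq> id"
  shows "card {p. f p = p} = 2"
proof -
  have fM: "f \<in> carrier moebius_group" using f H_moebius by blast
  obtain p where p: "f p = p" using moebius_fixed_point[OF fM] by blast
  obtain T where T: "T \<in> carrier moebius_group" "T p = None" using moebius_to_infinity by blast
  have bij: "bij T" using moebius_bij_inv T by blast
  have cancel: "inv' T (T x) = x" "T (inv' T x) = x" for x
    using bij by (simp_all add: bij_is_inj bij_is_surj surj_f_inv_f)
  obtain a b where ab: "T \<circ> f \<circ> inv' T = affine_map a b"
    using conjugate_affine[OF fM p T] by blast
  have "a \<noteq> 1" using no_translation[OF f(1) bij] ab f(2) by blast
  then have "affine_map a b (Some (b / (1 - a))) = Some (b / (1 - a))"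
    by (simp add: field_simps)
  then have "T (f (inv' T (Some (b / (1 - a))))) = Some (b / (1 - a))"
    unfolding ab[symmetric] by simp
  then obtain q where q: "f q = q" "T q = Some (b / (1 - a))" using cancel by metis
  have "p \<noteq> q" using T(2) q(2) by auto
  have "{x. f x = x} = {p, q}" using moebius_eq_id[OF fM p q(1)] \<open>p \<noteq> q\<close> f(2) p q(1) by auto
  then show ?thesis using \<open>p \<noteq> q\<close> by simp
qed

sublocale two_point_group H
  by unfold_locales (fact card_fixed_points, fact cyclic_point_stab)

end

section \<open>Rotations about zero and infinity\<close>

abbreviation multiplication :: "complex \<Rightarrow> riemann_sphere \<Rightarrow> riemann_sphere" where
  "multiplication a \<equiv> affine_map a 0"

definition moebius_stabilizer :: "riemann_sphere set \<Rightarrow> (riemann_sphere \<Rightarrow> riemann_sphere) set" where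
  "moebius_stabilizer \<alpha> = {f \<in> carrier moebius_group. f ` \<alpha> = \<alpha>}"

lemma setwise_stabilizer_eq: "setwise_stabilizer \<alpha> = transformation_monoid (moebius_stabilizer \<alpha>)"
  by (simp add: setwise_stabilizer_def moebius_group_def transformation_monoid_def moebius_stabilizer_def)

text \<open>
  A Moebius transformation is determined by its restriction to the set, which has at least three
  points, and there are only finitely many maps from a finite set to itself.
\<close>

lemma finite_moebius_group_stabilizer:
  assumes \<alpha>: "finite \<alpha>" "card \<alpha> \<ge> 3"
  shows "finite_moebius_group (moebius_stabilizer \<alpha>)"
proof
  let ?H = "moebius_stabilizer \<alpha>"
  have inv: "inv' f \<in> ?H" if "f \<in> ?H" for f
  proof -
    have f: "f \<in> carrier moebius_group" "f ` \<alpha> = \<alpha>" using that by (auto simp: moebius_stabilizer_def)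
    have "inv' f ` f ` \<alpha> = \<alpha>" using moebius_bij_inv(1)[OF f(1)] by (simp add: image_image bij_is_inj)
    then show ?thesis using f moebius_bij_inv(2)[OF f(1)] by (simp add: moebius_stabilizer_def)
  qed
  have comp: "f \<circ> g \<in> ?H" if "f \<in> ?H" "g \<in> ?H" for f g
    using that moebius_comp_mem[of f g] image_comp[of f g \<alpha>] by (simp add: moebius_stabilizer_def)
  have bij: "bij f" if "f \<in> ?H" for f
    using that moebius_bij_inv by (simp add: moebius_stabilizer_def)
  obtain p q r where pqr: "p \<in> \<alpha>" "q \<in> \<alpha>" "r \<in> \<alpha>" "p \<noteq> q" "p \<noteq> r" "q \<noteq> r"
  proof -
    obtain S where "S \<subseteq> \<alpha>" "card S = 3" using \<alpha>(2) by (metis obtain_subset_with_card_n)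
    then show ?thesis using that by (auto simp: card_3_iff)
  qed
  have "inj_on (\<lambda>f. restrict f \<alpha>) ?H"
  proof (rule inj_onI)
    fix f g assume fg: "f \<in> ?H" "g \<in> ?H" "restrict f \<alpha> = restrict g \<alpha>"
    have cancel: "inv' g (g x) = x" "g (inv' g x) = x" for x
      using bij[OF fg(2)] by (simp_all add: bij_is_inj bij_is_surj surj_f_inv_f)
    have "(inv' g \<circ> f) x = x" if "x \<in> \<alpha>" for x
      using that fg(3) cancel(1) by (metis comp_apply restrict_apply')
    moreover have "inv' g \<circ> f \<in> carrier moebius_group"
      using comp[OF inv[OF fg(2)] fg(1)] by (simp add: moebius_stabilizer_def)
    ultimately have "inv' g \<circ> f = id" using moebius_eq_id[of "inv' g \<circ> f" p q r] pqr by blast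
    then have "inv' g (f x) = x" for x by (metis comp_apply id_apply)
    then show "f = g" using cancel(2) by (metis ext)
  qed
  moreover have "(\<lambda>f. restrict f \<alpha>) ` ?H \<subseteq> \<alpha> \<rightarrow>\<^sub>E \<alpha>"
    by (auto simp: moebius_stabilizer_def)
  moreover have "finite (\<alpha> \<rightarrow>\<^sub>E \<alpha>)" using \<alpha>(1) by (simp add: finite_PiE)
  ultimately show "finite ?H" by (meson finite_imageD finite_subset)
  show "id \<in> ?H" using moebius_id_mem by (simp add: moebius_stabilizer_def)
  show "?H \<subseteq> carrier moebius_group" by (auto simp: moebius_stabilizer_def)
  show "f \<circ> g \<in> ?H" if "f \<in> ?H" "g \<in> ?H" for f g using that by (rule comp)
  show "bij f" "inv' f \<in> ?H" if "f \<in> ?H" for f using bij[OF that] inv[OF that] .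
qed

lemma exp_eq_cis: "exp (2 * of_real pi * \<i> / of_nat n) = cis (2 * pi / real n)"
  by (simp add: cis_conv_exp mult.commute)

lemma rotation_eq: "rotation n = multiplication (cis (2 * pi / real n))"
  by (simp add: rotation_def affine_map_def exp_eq_cis)

lemma root_unity_nonzero: "n > 0 \<Longrightarrow> (a::complex) ^ n = 1 \<Longrightarrow> a \<noteq> 0"
  by (auto simp: power_0_left)

lemma rotation_group_eq:
  assumes n: "n > 0"
  shows "rotation_group n = transformation_monoid (multiplication ` {a. a ^ n = 1})"
proof -
  interpret group moebius_group by (rule group_moebius_group)
  let ?R = "multiplication ` {a. a ^ n = 1}"
  let ?\<zeta> = "cis (2 * pi / real n)"
  have one: "\<one>\<^bsub>moebius_group\<^esub> = multiplication 1" by (simp add: moebius_group_def affine_map_id)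
  have mult: "multiplication a \<otimes>\<^bsub>moebius_group\<^esub> multiplication b = multiplication (a * b)" for a b
    by (simp add: moebius_group_def affine_map_comp)
  have mem: "multiplication a \<in> carrier moebius_group" if "a ^ n = 1" for a
    using affine_map_mem root_unity_nonzero[OF n that] by blast
  have "generate moebius_group {rotation n} = ?R"
  proof
    have "subgroup ?R moebius_group"
    proof (rule subgroupI)
      fix f assume "f \<in> ?R"
      then obtain a where a: "a ^ n = 1" "f = multiplication a" by blast
      have "multiplication (inverse a) \<otimes>\<^bsub>moebius_group\<^esub> f = \<one>\<^bsub>moebius_group\<^esub>"
        using root_unity_nonzero[OF n a(1)] by (simp add: a(2) mult one)
      then have "inv\<^bsub>moebius_group\<^esub> f = multiplication (inverse a)"
        using a mem by (intro inv_equality) (simp_all add: power_inverse)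
      then show "inv\<^bsub>moebius_group\<^esub> f \<in> ?R" using a by (auto simp: power_inverse)
    next
      fix f g assume "f \<in> ?R" "g \<in> ?R"
      then show "f \<otimes>\<^bsub>moebius_group\<^esub> g \<in> ?R"
        by (auto simp: mult power_mult_distrib)
    qed (use mem in \<open>auto intro: exI[of _ 1]\<close>)
    moreover have "rotation n \<in> ?R"
      using n by (simp add: rotation_eq DeMoivre)
    ultimately show "generate moebius_group {rotation n} \<subseteq> ?R"
      by (intro generate_subgroup_incl) simp_all
    have pow: "multiplication (?\<zeta> ^ k) \<in> generate moebius_group {rotation n}" for k
    proof (induction k)
      case 0
      then show ?case using generate.one[of moebius_group] one by simp
    next
      case (Suc k)
      have "rotation n \<in> generate moebius_group {rotation n}" by (rule generate.incl) simp
      from generate.eng[OF this Suc] show ?case by (simp add: rotation_eq mult)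
    qed
    show "?R \<subseteq> generate moebius_group {rotation n}"
    proof
      fix f assume "f \<in> ?R"
      then obtain a where a: "a ^ n = 1" "f = multiplication a" by blast
      obtain k where "a = ?\<zeta> ^ k" using root_unity_power[OF n a(1)] .
      then show "f \<in> generate moebius_group {rotation n}" using pow a(2) by simp
    qed
  qed
  then show ?thesis
    using rotation_in_moebius_group[of n]
    by (simp add: rotation_group_def subgroup_generated_def moebius_group_def transformation_monoid_def)
qed

lemma circle_orbit_eq:
  assumes m: "m > 0"
  shows "circle_orbit m z = {Some (a * z) | a. a ^ m = 1}"
proof -
  have roots: "{exp (of_int j / of_nat m * 2 * of_real pi * \<i>) | j :: int. True} = {a :: complex. a ^ m = 1}"
  proof
    have "exp (of_int j / of_nat m * 2 * of_real pi * \<i>) ^ m = (1::complex)" for j :: int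
    proof -
      have "exp (of_int j / of_nat m * 2 * of_real pi * \<i>) ^ m = exp (2 * of_int j * of_real pi * \<i>)"
        using m by (simp add: exp_of_nat_mult[symmetric] mult.commute)
      also have "\<dots> = cis (2 * pi * of_int j)" by (simp add: cis_conv_exp mult_ac)
      finally show ?thesis by simp
    qed
    then show "{exp (of_int j / of_nat m * 2 * of_real pi * \<i>) | j :: int. True} \<subseteq> {a :: complex. a ^ m = 1}"
      by blast
    show "{a :: complex. a ^ m = 1} \<subseteq> {exp (of_int j / of_nat m * 2 * of_real pi * \<i>) | j :: int. True}"
    proof
      fix a :: complex assume "a \<in> {a. a ^ m = 1}"
      then obtain k where "a = cis (2 * pi / real m) ^ k" using root_unity_power[OF m, of a] by auto
      then have "a = exp (of_int (int k) / of_nat m * 2 * of_real pi * \<i>)"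
        by (simp add: cis_conv_exp exp_of_nat_mult[symmetric] mult_ac)
      then show "a \<in> {exp (of_int j / of_nat m * 2 * of_real pi * \<i>) | j :: int. True}" by blast
    qed
  qed
  have "circle_orbit m z =
      (\<lambda>a. Some (a * z)) ` {exp (of_int j / of_nat m * 2 * of_real pi * \<i>) | j :: int. True}"
    by (auto simp: circle_orbit_def)
  then show ?thesis by (simp only: roots setcompr_eq_image)
qed

text \<open>
  The blocks are the orbits of the rotation group of order \<open>m\<close>: the two fixed points and the circle
  orbits.
\<close>

lemma union_of_blocks_iff:
  assumes m: "m > 0"
  shows "(\<exists>F. F \<subseteq> blocks m \<and> \<alpha> = \<Union> F) \<longleftrightarrow>
    multiplication ` {a. a ^ m = 1} \<subseteq> moebius_stabilizer \<alpha>" (is "?union \<longleftrightarrow> ?invariant")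
proof
  assume ?union
  then obtain F where F: "F \<subseteq> blocks m" "\<alpha> = \<Union> F" by blast
  have closed: "multiplication a x \<in> \<alpha>" if a: "a ^ m = 1" and x: "x \<in> \<alpha>" for a x
  proof -
    obtain B where B: "B \<in> F" "x \<in> B" using F x by blast
    then have "B \<in> blocks m" using F by blast
    moreover have "(a * b) ^ m = 1" if "b ^ m = 1" for b
      using a that by (simp add: power_mult_distrib)
    ultimately have "multiplication a x \<in> B"
      using B(2) unfolding blocks_def by (auto simp: circle_orbit_eq[OF m])
    then show ?thesis using F B by blast
  qed
  show ?invariant
  proof
    fix f assume "f \<in> multiplication ` {a. a ^ m = 1}"
    then obtain a where a: "a ^ m = 1" "f = multiplication a" by blast
    have nz: "a \<noteq> 0" by (rule root_unity_nonzero[OF m a(1)])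
    have "x \<in> f ` \<alpha>" if "x \<in> \<alpha>" for x
    proof
      show "x = f (multiplication (inverse a) x)" using nz by (cases x) (simp_all add: a(2))
      show "multiplication (inverse a) x \<in> \<alpha>" using closed that a(1) by (simp add: power_inverse)
    qed
    then have "f ` \<alpha> = \<alpha>" using closed[OF a(1)] a(2) by blast
    then show "f \<in> moebius_stabilizer \<alpha>"
      using affine_map_mem nz a(2) by (simp add: moebius_stabilizer_def)
  qed
next
  assume inv: ?invariant
  have closed: "multiplication a x \<in> \<alpha>" if "a ^ m = 1" "x \<in> \<alpha>" for a x
    using that inv by (fastforce simp: moebius_stabilizer_def)
  let ?F = "{B \<in> blocks m. B \<subseteq> \<alpha>}"
  have "\<exists>B\<in>?F. x \<in> B" if x: "x \<in> \<alpha>" for x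
  proof (cases "x \<in> {None, Some 0}")
    case True
    then have "{x} \<in> blocks m" by (auto simp: blocks_def)
    then show ?thesis using x by (intro bexI[of _ "{x}"]) auto
  next
    case False
    then obtain z where z: "x = Some z" "z \<noteq> 0" by (cases x) auto
    have "circle_orbit m z \<subseteq> \<alpha>"
      using closed x z(1) by (force simp: circle_orbit_eq[OF m])
    moreover have "x \<in> circle_orbit m z"
      unfolding circle_orbit_eq[OF m] z(1) by (intro CollectI exI[of _ 1]) simp
    ultimately show ?thesis using z(2) by (auto simp: blocks_def)
  qed
  then have "\<alpha> = \<Union> ?F" by blast
  moreover have "?F \<subseteq> blocks m" by blast
  ultimately show ?union by (intro exI[of _ ?F] conjI)
qed

lemma inj_multiplication: "inj multiplication"
  by (simp add: inj_on_def affine_map_eq_iff)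

text \<open>
  The nontrivial multiplication by \<open>\<zeta>\<close> fixes only \<open>0\<close> and \<open>\<infinity>\<close>, so \<open>p\<close> is one of them and
  the whole group fixes both. An affine map that fixes \<open>0\<close> is a multiplication.
\<close>

lemma (in finite_moebius_group) fixed_point_multiplications:
  assumes p: "stab p = H"
    and \<zeta>: "multiplication \<zeta> \<in> H" "\<zeta> \<noteq> 1"
  obtains N where "N > 0" "H = multiplication ` {a. a ^ N = 1}"
proof -
  have nid: "multiplication \<zeta> \<noteq> id"
    using \<zeta>(2) affine_map_eq_iff[of \<zeta> 0 1 0] by (simp add: affine_map_id)
  have "multiplication \<zeta> p = p" using \<zeta>(1) p unfolding stab_def by blast
  then have "p = None \<or> p = Some 0" using \<zeta>(2) by (cases p) auto
  moreover have "stab None = stab (Some 0)" using stab_eq[OF \<zeta>(1) nid] by simp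
  ultimately have "stab None = H" "stab (Some 0) = H" using p by auto
  then have fixed: "f None = None" "f (Some 0) = Some 0" if "f \<in> H" for f
    using that unfolding stab_def by blast+
  define M where "M = {a. a \<noteq> 0 \<and> multiplication a \<in> H}"
  have HM: "H = multiplication ` M"
  proof
    show "H \<subseteq> multiplication ` M"
    proof
      fix f assume f: "f \<in> H"
      obtain a b where ab: "a \<noteq> 0" "f = affine_map a b"
        using fixes_infinity_affine[of f] f H_moebius fixed(1) by blast
      then have "b = 0" using fixed(2)[OF f] by simp
      then show "f \<in> multiplication ` M" using ab f by (auto simp: M_def)
    qed
  qed (auto simp: M_def)
  have "finite M"
    using finite_H inj_on_subset[OF inj_multiplication subset_UNIV[of M]] unfolding HM
    by (simp add: finite_image_iff)
  moreover have "1 \<in> M" using id_mem by (simp add: M_def affine_map_id)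
  moreover have "a * b \<in> M" if "a \<in> M" "b \<in> M" for a b
    using that comp_mem[of "multiplication a" "multiplication b"]
    by (simp add: M_def affine_map_comp)
  moreover have "0 \<notin> M" by (simp add: M_def)
  ultimately have "M = {a. a ^ card M = 1}" "card M > 0"
    using finite_mult_closed_eq_roots_unity[of M] card_gt_0_iff[of M] by blast+
  then show ?thesis using that HM by metis
qed

lemma iso_commute:
  assumes "G \<cong> K" and comm: "\<And>a b. a \<in> carrier G \<Longrightarrow> b \<in> carrier G \<Longrightarrow> a \<otimes>\<^bsub>G\<^esub> b = b \<otimes>\<^bsub>G\<^esub> a"
    and x: "x \<in> carrier K" and y: "y \<in> carrier K"
  shows "x \<otimes>\<^bsub>K\<^esub> y = y \<otimes>\<^bsub>K\<^esub> x"
proof -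
  obtain \<phi> where \<phi>: "\<phi> \<in> hom G K" "\<phi> ` carrier G = carrier K"
    using assms(1) by (auto simp: is_iso_def iso_def bij_betw_def)
  obtain a b where "a \<in> carrier G" "b \<in> carrier G" "x = \<phi> a" "y = \<phi> b"
    using x y \<phi>(2) by blast
  then show ?thesis using comm hom_mult[OF \<phi>(1)] by metis
qed

text \<open>
  The witnesses are the 3-cycles on \<open>{1, 2, 3}\<close> and \<open>{1, 2, 4}\<close>.
\<close>

lemma alt_group_not_commutative:
  assumes "n \<ge> 4"
  obtains p q where "p \<in> carrier (alt_group n)" "q \<in> carrier (alt_group n)" "p \<circ> q \<noteq> q \<circ> p"
proof
  let ?p = "transpose 1 2 \<circ> transpose 2 3 :: nat \<Rightarrow> nat"
  let ?q = "transpose 1 2 \<circ> transpose 2 4 :: nat \<Rightarrow> nat"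
  show "?p \<in> carrier (alt_group n)" "?q \<in> carrier (alt_group n)"
    using assms unfolding alt_group_carrier
    by (auto intro!: permutes_compose permutes_swap_id simp: evenperm_comp permutation_swap_id evenperm_swap)
  have "(?p \<circ> ?q) 1 \<noteq> (?q \<circ> ?p) 1" by (simp add: transpose_def)
  then show "?p \<circ> ?q \<noteq> ?q \<circ> ?p" by metis
qed

text \<open>
  A commuting rotation and reflection give \<open>r = r\<^sup>-\<^sup>1\<close>, so \<open>m\<close> divides 2.
\<close>

lemma dihedral_group_commutative:
  assumes "m \<ge> 2"
    and "\<And>x y. x \<in> carrier (dihedral_group m) \<Longrightarrow> y \<in> carrier (dihedral_group m) \<Longrightarrow>
      x \<otimes>\<^bsub>dihedral_group m\<^esub> y = y \<otimes>\<^bsub>dihedral_group m\<^esub> x"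
  shows "m = 2"
proof -
  have "(1, False) \<otimes>\<^bsub>dihedral_group m\<^esub> (0, True) = (0, True) \<otimes>\<^bsub>dihedral_group m\<^esub> (1, False)"
    using assms(1) by (intro assms(2)) (auto simp: dihedral_group_def)
  then have "1 mod int m = (- 1) mod int m" by (simp add: dihedral_group_def)
  then have "int m dvd 1 - (- 1)" by (simp add: mod_eq_dvd_iff)
  then have "int m \<le> 2" by (intro zdvd_imp_le) simp_all
  then show ?thesis using assms(1) by simp
qed

lemma card_multiplication_roots:
  "n > 0 \<Longrightarrow> card (multiplication ` {a. a ^ n = 1}) = n"
  using inj_on_subset[OF inj_multiplication subset_UNIV]
  by (simp add: card_image card_roots_unity_eq)

lemma multiplication_group_iso_commute:
  assumes "transformation_monoid (multiplication ` A) \<cong> K" "x \<in> carrier K" "y \<in> carrier K"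
  shows "x \<otimes>\<^bsub>K\<^esub> y = y \<otimes>\<^bsub>K\<^esub> x"
  by (rule iso_commute[OF assms(1) _ assms(2,3)]) (auto simp: affine_map_comp mult.commute)

text \<open>
  Commutativity excludes everything but the Klein four-group. That group would require \<open>n = 4\<close>, but
  multiplication by \<open>\<i>\<close> then has a nontrivial square.
\<close>

lemma cyclic_not_platonic_or_dihedral:
  assumes n: "n > 0"
  shows "\<not> (transformation_monoid (multiplication ` {a. a ^ n = 1}) \<cong> alt_group 5 \<or>
       transformation_monoid (multiplication ` {a. a ^ n = 1}) \<cong> sym_group 4 \<or>
       transformation_monoid (multiplication ` {a. a ^ n = 1}) \<cong> alt_group 4 \<or>
       (\<exists>m\<ge>2. transformation_monoid (multiplication ` {a. a ^ n = 1}) \<cong> dihedral_group m))"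
proof -
  let ?R = "transformation_monoid (multiplication ` {a. a ^ n = 1})"
  have alt: "\<not> ?R \<cong> alt_group k" if k: "k \<ge> 4" for k
  proof
    assume iso: "?R \<cong> alt_group k"
    obtain p q where "p \<in> carrier (alt_group k)" "q \<in> carrier (alt_group k)" "p \<circ> q \<noteq> q \<circ> p"
      using alt_group_not_commutative[OF k] .
    then show False using multiplication_group_iso_commute[OF iso] by (metis alt_group_mult)
  qed
  have sym: "\<not> ?R \<cong> sym_group 4"
  proof
    assume iso: "?R \<cong> sym_group 4"
    obtain p q where "p \<in> carrier (alt_group 4)" "q \<in> carrier (alt_group 4)" "p \<circ> q \<noteq> q \<circ> p"
      using alt_group_not_commutative[of 4] by blast
    then show False using multiplication_group_iso_commute[OF iso]
      by (metis alt_group_carrier sym_group_carrier sym_group_mult)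
  qed
  have dih: "\<not> ?R \<cong> dihedral_group m" if m: "m \<ge> 2" for m
  proof
    assume iso: "?R \<cong> dihedral_group m"
    then have "m = 2" using dihedral_group_commutative[OF m] multiplication_group_iso_commute[OF iso] by blast
    obtain \<phi> where \<phi>: "\<phi> \<in> hom ?R (dihedral_group 2)" "bij_betw \<phi> (carrier ?R) (carrier (dihedral_group 2))"
      using iso \<open>m = 2\<close> by (auto simp: is_iso_def iso_def)
    have "card (carrier ?R) = 4"
      using bij_betw_same_card[OF \<phi>(2)] by (simp add: dihedral_group_def card_cartesian_product)
    then have "n = 4" using card_multiplication_roots[OF n] by simp
    have square: "x \<otimes>\<^bsub>dihedral_group 2\<^esub> x = \<one>\<^bsub>dihedral_group 2\<^esub>" for x
      by (cases x) (auto simp: dihedral_group_def)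
    let ?i = "multiplication \<i>"
    have i: "?i \<in> carrier ?R" "id \<in> carrier ?R"
      using \<open>n = 4\<close> affine_map_id by (auto simp: power4_eq_xxxx intro: image_eqI[of _ _ 1])
    have "\<phi> (?i \<circ> ?i) = \<phi> (id \<circ> id)"
      using hom_mult[OF \<phi>(1) i(1,1)] hom_mult[OF \<phi>(1) i(2,2)] by (simp add: square)
    moreover have "?i \<circ> ?i = multiplication (- 1)" by (simp add: affine_map_comp)
    moreover have "multiplication (- 1) \<in> carrier ?R" using \<open>n = 4\<close> by simp
    ultimately have "multiplication (- 1) = id"
      using inj_onD[OF bij_betw_imp_inj_on[OF \<phi>(2)] _ _ i(2)] by simp
    then show False using affine_map_eq_iff[of "- 1" 0 1 0] by (simp add: affine_map_id)
  qed
  show ?thesis using alt[of 5] alt[of 4] sym dih by auto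
qed

theorem theorem12:
  fixes n :: nat and \<alpha> :: "riemann_sphere set"
  assumes "n \<ge> 2" and "finite \<alpha>" and "card \<alpha> \<ge> 3"
  shows "setwise_stabilizer \<alpha> = rotation_group n \<longleftrightarrow>
    (\<exists>F. F \<subseteq> blocks n \<and> \<alpha> = \<Union> F) \<and>
    (\<forall>p::nat. p \<ge> 2 \<longrightarrow> \<not> (\<exists>F. F \<subseteq> blocks (p * n) \<and> \<alpha> = \<Union> F)) \<and>
    \<not> (setwise_stabilizer \<alpha> \<cong> alt_group 5 \<or>
       setwise_stabilizer \<alpha> \<cong> sym_group 4 \<or>
       setwise_stabilizer \<alpha> \<cong> alt_group 4 \<or>
       (\<exists>m::nat. m \<ge> 2 \<and> setwise_stabilizer \<alpha> \<cong> dihedral_group m))"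
proof -
  let ?R = "\<lambda>k::nat. multiplication ` {a. a ^ k = 1}"
  define H where "H = moebius_stabilizer \<alpha>"
  have n: "n > 0" using assms(1) by simp
  interpret finite_moebius_group H
    unfolding H_def by (rule finite_moebius_group_stabilizer[OF assms(2,3)])
  have stab: "setwise_stabilizer \<alpha> = transformation_monoid H"
    by (simp add: setwise_stabilizer_eq H_def)
  have blocks: "(\<exists>F. F \<subseteq> blocks k \<and> \<alpha> = \<Union> F) \<longleftrightarrow> ?R k \<subseteq> H" if "k > 0" for k
    using union_of_blocks_iff[OF that] by (simp add: H_def)
  have "transformation_monoid H = rotation_group n \<longleftrightarrow> H = ?R n"
    unfolding rotation_group_eq[OF n] by (simp add: transformation_monoid_def)
  moreover have "H = ?R n \<longleftrightarrow>
    ?R n \<subseteq> H \<and> (\<forall>p\<ge>2. \<not> ?R (p * n) \<subseteq> H) \<and>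
    \<not> (transformation_monoid H \<cong> alt_group 5 \<or> transformation_monoid H \<cong> sym_group 4 \<or>
       transformation_monoid H \<cong> alt_group 4 \<or> (\<exists>m\<ge>2. transformation_monoid H \<cong> dihedral_group m))"
    (is "_ \<longleftrightarrow> ?orbits \<and> ?maximal \<and> ?cyclic")
  proof
    assume H: "H = ?R n"
    have "\<not> ?R (p * n) \<subseteq> H" if p: "p \<ge> 2" for p
    proof
      assume "?R (p * n) \<subseteq> H"
      then have "card (?R (p * n)) \<le> card H" by (rule card_mono[OF finite_H])
      then have "p * n \<le> n" using card_multiplication_roots n p by (simp add: H)
      then show False using n p by simp
    qed
    moreover have "?cyclic" using cyclic_not_platonic_or_dihedral[OF n] unfolding H .
    ultimately show "?orbits \<and> ?maximal \<and> ?cyclic" using H by blast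
  next
    assume "?orbits \<and> ?maximal \<and> ?cyclic"
    then have orbits: "?orbits" and maximal: "?maximal" and cyclic: "?cyclic" by blast+
    have "card H \<ge> card (?R n)" using orbits by (rule card_mono[OF finite_H])
    then have "card H \<ge> 2" using card_multiplication_roots[OF n] assms(1) by simp
    then obtain x where x: "stab x = H" using classification cyclic by blast
    let ?\<zeta> = "cis (2 * pi / real n)"
    have \<zeta>: "multiplication ?\<zeta> \<in> H" using orbits n by (auto simp: DeMoivre)
    have "?\<zeta> \<noteq> 1" using cis_power_eq_1_iff[OF n, of 1] assms(1) by simp
    then obtain N where N: "N > 0" "H = ?R N"
      using fixed_point_multiplications[OF x \<zeta>] by blast
    have "?\<zeta> ^ N = 1" using \<zeta> unfolding N(2) by (auto simp: affine_map_eq_iff)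
    then obtain p where p: "N = p * n"
      using cis_power_eq_1_iff[OF n] by (metis dvd_def mult.commute)
    have "\<not> p \<ge> 2" using maximal N(2) p by blast
    moreover have "p \<noteq> 0" using N(1) p by (intro notI) simp
    ultimately have "p = 1" by linarith
    then show "H = ?R n" using N(2) p by simp
  qed
  ultimately show ?thesis using blocks n unfolding stab by simp
qed

end
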